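(* Let $\mathbb{K}$ be a field, let $\mathcal{J}$ be a set of pairwise non-equivalent $\mathbb{K}$-linear triangulated categories, and let $F:\mathcal{T}_1\to\mathcal{T}_2$ be a fully faithful exact $\mathbb{K}$-linear functor between $\mathbb{K}$-linear triangulated categories. Then the assignment $\mathcal{B}\mapsto F(\mathcal{B})$ is a well-defined injective map $C_{\mathcal{J},\mathbb{K}}(\mathcal{T}_1)\to C_{\mathcal{J},\mathbb{K}}(\mathcal{T}_2)$ which preserves the additional structures on these sets, that is: (i) for $x,y\in C_{\mathcal{J},\mathbb{K}}(\mathcal{T}_1)$ one has $x\le y$ if and only if $F(x)\le F(y)$; (ii) for $a,b\in C_{\mathcal{J},\mathbb{K}}(\mathcal{T}_1)$, the pair $(a,b)$ is an edge of $G_{\mathcal{J},\mathbb{K}}(\mathcal{T}_1)$ if and only if $(F(a),F(b))$ is an edge of $G_{\mathcal{J},\mathbb{K}}(\mathcal{T}_2)$; in particular the map sends simplices of $SC_{\mathcal{J},\mathbb{K}}(\mathcal{T}_1)$ to simplices of $SC_{\mathcal{J},\mathbb{K}}(\mathcal{T}_2)$; (iii) if $\mathcal{J}=\{D^b(A_1)\}$, then the number attached to a one-sided edge $(a,b)$ of $G_{\mathcal{J},\mathbb{K}}(\mathcal{T}_1)$ equals the number attached to the edge $(F(a),F(b))$ of $G_{\mathcal{J},\mathbb{K}}(\mathcal{T}_2)$.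
   Context: A triangulated subcategory of a triangulated category $\mathcal{T}$ is a non-empty full subcategory closed under $[1]$, $[-1]$ and extensions (hence closed under isomorphisms). For a fully faithful exact functor $F:\mathcal{T}_1\to\mathcal{T}_2$ and a triangulated subcategory $\mathcal{B}\subset\mathcal{T}_1$, $F(\mathcal{B})$ denotes the full subcategory of $\mathcal{T}_2$ with objects $\{X: X\cong F(A)\text{ for some }A\in\mathcal{B}\}$; it is a triangulated subcategory. For a set $\mathcal{J}$ of pairwise non-equivalent $\mathbb{K}$-linear triangulated categories and a $\mathbb{K}$-linear triangulated category $\mathcal{T}$, $C_{\mathcal{J},\mathbb{K}}(\mathcal{T})$ is the set of all triangulated subcategories $\mathcal{B}\subset\mathcal{T}$ for which there exist $\mathcal{A}\in\mathcal{J}$ and a $\mathbb{K}$-linear exact equivalence $\mathcal{A}\to\mathcal{B}$. Partial order: $x\le y$ iff $\mathrm{Ob}(x)\subset \mathrm{Ob}(y)$. $G_{\mathcal{J},\mathbb{K}}(\mathcal{T})$ is the directed graph with vertex set $C_{\mathcal{J},\mathbb{K}}(\mathcal{T})$ and edges the pairs $(\mathcal{B}_1,\mathcal{B}_2)$ of different vertices such that $\mathrm{Hom}(X_2,X_1)=0$ for all $X_2\in\mathcal{B}_2$, $X_1\in\mathcal{B}_1$. $SC_{\mathcal{J},\mathbb{K}}(\mathcal{T})$ is the simplicial complex with the same vertices, whose simplices are the non-empty finite sets of vertices that can be ordered as $x_1,\dots,x_n$ so that $(x_i,x_j)$ is an edge for all $1\le i<j\le n$. $D^b(A_1)$ is the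 bounded derived category of finite dimensional $\mathbb{K}$-vector spaces. If $\mathcal{J}=\{D^b(A_1)\}$, the vertices are the subcategories $\langle E\rangle$ generated by an exceptional object $E$ (i.e. $\mathrm{Hom}(E,E)=\mathbb{K}$, $\mathrm{Hom}(E,E[i])=0$ for $i\ne0$). To an edge $(a,b)$ such that $(b,a)$ is not an edge (a one-sided edge) one attaches the number $\sum_{i\in\mathbb{Z}}\dim_{\mathbb{K}}\mathrm{Hom}(X,Y[i])$, where $X,Y$ are exceptional objects with $a=\langle X\rangle$, $b=\langle Y\rangle$. *)

theory Defs
  imports
    "HOL-Analysis.Infinite_Sum"
    "HOL-Library.Extended_Real"
    "Jordan_Normal_Form.VS_Connect"
    "Graph_Theory.Pair_Digraph"
begin

section \<open>Categories and functors\<close>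

record ('o, 'm) cat =
  Obj :: "'o set"
  Hom :: "'o \<Rightarrow> 'o \<Rightarrow> 'm set"
  Ident :: "'o \<Rightarrow> 'm"
  Comp :: "'m \<Rightarrow> 'm \<Rightarrow> 'm"  (infixr \<open>\<cdot>\<index>\<close> 70)

locale category =
  fixes C :: "('o, 'm, 'z) cat_scheme" (structure)
  assumes Hom_disjoint:
      "\<lbrakk>A \<in> Obj C; B \<in> Obj C; A' \<in> Obj C; B' \<in> Obj C; f \<in> Hom C A B; f \<in> Hom C A' B'\<rbrakk>
        \<Longrightarrow> A = A' \<and> B = B'"
    and Ident_in_Hom: "A \<in> Obj C \<Longrightarrow> Ident C A \<in> Hom C A A"
    and Comp_in_Hom:
      "\<lbrakk>A \<in> Obj C; B \<in> Obj C; D \<in> Obj C; f \<in> Hom C A B; g \<in> Hom C B D\<rbrakk> \<Longrightarrow> g \<cdot> f \<in> Hom C A D"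
    and Ident_left: "\<lbrakk>A \<in> Obj C; B \<in> Obj C; f \<in> Hom C A B\<rbrakk> \<Longrightarrow> Ident C B \<cdot> f = f"
    and Ident_right: "\<lbrakk>A \<in> Obj C; B \<in> Obj C; f \<in> Hom C A B\<rbrakk> \<Longrightarrow> f \<cdot> Ident C A = f"
    and Comp_assoc:
      "\<lbrakk>A \<in> Obj C; B \<in> Obj C; D \<in> Obj C; E \<in> Obj C;
        f \<in> Hom C A B; g \<in> Hom C B D; h \<in> Hom C D E\<rbrakk> \<Longrightarrow> (h \<cdot> g) \<cdot> f = h \<cdot> (g \<cdot> f)"

definition iso_arr :: "('o, 'm, 'z) cat_scheme \<Rightarrow> 'o \<Rightarrow> 'o \<Rightarrow> 'm \<Rightarrow> bool" where
  "iso_arr C A B f \<longleftrightarrow> A \<in> Obj C \<and> B \<in> Obj C \<and> f \<in> Hom C A B \<and>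
     (\<exists>g \<in> Hom C B A. g \<cdot>\<^bsub>C\<^esub> f = Ident C A \<and> f \<cdot>\<^bsub>C\<^esub> g = Ident C B)"

definition isomorphic :: "('o, 'm, 'z) cat_scheme \<Rightarrow> 'o \<Rightarrow> 'o \<Rightarrow> bool" where
  "isomorphic C A B \<longleftrightarrow> (\<exists>f. iso_arr C A B f)"

record ('o1, 'm1, 'o2, 'm2) fctr =
  OMap :: "'o1 \<Rightarrow> 'o2"
  MMap :: "'m1 \<Rightarrow> 'm2"

definition id_fctr :: "('o, 'm, 'o, 'm) fctr" where
  "id_fctr = \<lparr>OMap = (\<lambda>A. A), MMap = (\<lambda>f. f)\<rparr>"

definition comp_fctr ::
  "('o2, 'm2, 'o3, 'm3) fctr \<Rightarrow> ('o1, 'm1, 'o2, 'm2) fctr \<Rightarrow> ('o1, 'm1, 'o3, 'm3) fctr" where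
  "comp_fctr G F = \<lparr>OMap = (\<lambda>A. OMap G (OMap F A)), MMap = (\<lambda>f. MMap G (MMap F f))\<rparr>"

definition is_functor ::
  "('o1, 'm1, 'z1) cat_scheme \<Rightarrow> ('o2, 'm2, 'z2) cat_scheme \<Rightarrow> ('o1, 'm1, 'o2, 'm2) fctr \<Rightarrow> bool" where
  "is_functor C D F \<longleftrightarrow>
     (\<forall>A \<in> Obj C. OMap F A \<in> Obj D) \<and>
     (\<forall>A \<in> Obj C. \<forall>B \<in> Obj C. \<forall>f \<in> Hom C A B. MMap F f \<in> Hom D (OMap F A) (OMap F B)) \<and>
     (\<forall>A \<in> Obj C. MMap F (Ident C A) = Ident D (OMap F A)) \<and>
     (\<forall>A \<in> Obj C. \<forall>B \<in> Obj C. \<forall>E \<in> Obj C. \<forall>f \<in> Hom C A B. \<forall>g \<in> Hom C B E.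
        MMap F (g \<cdot>\<^bsub>C\<^esub> f) = MMap F g \<cdot>\<^bsub>D\<^esub> MMap F f)"

definition fully_faithful ::
  "('o1, 'm1, 'z1) cat_scheme \<Rightarrow> ('o2, 'm2, 'z2) cat_scheme \<Rightarrow> ('o1, 'm1, 'o2, 'm2) fctr \<Rightarrow> bool" where
  "fully_faithful C D F \<longleftrightarrow>
     (\<forall>A \<in> Obj C. \<forall>B \<in> Obj C. bij_betw (MMap F) (Hom C A B) (Hom D (OMap F A) (OMap F B)))"

definition nat_iso ::
  "('o1, 'm1, 'z1) cat_scheme \<Rightarrow> ('o2, 'm2, 'z2) cat_scheme \<Rightarrow>
   ('o1, 'm1, 'o2, 'm2) fctr \<Rightarrow> ('o1, 'm1, 'o2, 'm2) fctr \<Rightarrow> ('o1 \<Rightarrow> 'm2) \<Rightarrow> bool" where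
  "nat_iso C D F G \<eta> \<longleftrightarrow>
     (\<forall>A \<in> Obj C. iso_arr D (OMap F A) (OMap G A) (\<eta> A)) \<and>
     (\<forall>A \<in> Obj C. \<forall>B \<in> Obj C. \<forall>f \<in> Hom C A B. \<eta> B \<cdot>\<^bsub>D\<^esub> MMap F f = MMap G f \<cdot>\<^bsub>D\<^esub> \<eta> A)"

definition equivalence ::
  "('o1, 'm1, 'z1) cat_scheme \<Rightarrow> ('o2, 'm2, 'z2) cat_scheme \<Rightarrow> ('o1, 'm1, 'o2, 'm2) fctr \<Rightarrow> bool" where
  "equivalence C D F \<longleftrightarrow> is_functor C D F \<and>
     (\<exists>G. is_functor D C G \<and> (\<exists>\<eta>. nat_iso C C (comp_fctr G F) id_fctr \<eta>) \<and>
        (\<exists>\<epsilon>. nat_iso D D (comp_fctr F G) id_fctr \<epsilon>))"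

section \<open>Linear and additive categories\<close>

text \<open>The ground field is the type \<open>'k\<close> of class \<open>field\<close>; \<open>class_ring\<close> is that field as a ring
  with carrier \<open>UNIV\<close>.\<close>

record ('o, 'm, 'k) lincat = "('o, 'm) cat" +
  Zero :: "'o \<Rightarrow> 'o \<Rightarrow> 'm"
  Plus :: "'m \<Rightarrow> 'm \<Rightarrow> 'm"
  Scale :: "'k \<Rightarrow> 'm \<Rightarrow> 'm"

text \<open>The fields \<open>mult\<close> and \<open>one\<close> are inherited from the ring record and irrelevant for modules.\<close>

definition hom_space ::
  "('o, 'm, 'k, 'z) lincat_scheme \<Rightarrow> 'o \<Rightarrow> 'o \<Rightarrow> ('k, 'm) module" where
  "hom_space C A B = \<lparr>carrier = Hom C A B, mult = undefined, one = undefined,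
     zero = Zero C A B, add = Plus C, smult = Scale C\<rparr>"

definition hom_dim :: "('o, 'm, 'k::field, 'z) lincat_scheme \<Rightarrow> 'o \<Rightarrow> 'o \<Rightarrow> enat" where
  "hom_dim C A B =
     (if vectorspace.fin_dim (class_ring :: 'k ring) (hom_space C A B)
      then enat (vectorspace.dim (class_ring :: 'k ring) (hom_space C A B)) else \<infinity>)"

locale linear_category = category C
  for C :: "('o, 'm, 'k::field, 'z) lincat_scheme" (structure) +
  assumes hom_vectorspace:
      "\<lbrakk>A \<in> Obj C; B \<in> Obj C\<rbrakk> \<Longrightarrow> vectorspace (class_ring :: 'k ring) (hom_space C A B)"
    and Comp_Plus_left:
      "\<lbrakk>A \<in> Obj C; B \<in> Obj C; D \<in> Obj C; f \<in> Hom C A B; g \<in> Hom C B D; g' \<in> Hom C B D\<rbrakk>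
        \<Longrightarrow> Plus C g g' \<cdot> f = Plus C (g \<cdot> f) (g' \<cdot> f)"
    and Comp_Plus_right:
      "\<lbrakk>A \<in> Obj C; B \<in> Obj C; D \<in> Obj C; f \<in> Hom C A B; f' \<in> Hom C A B; g \<in> Hom C B D\<rbrakk>
        \<Longrightarrow> g \<cdot> Plus C f f' = Plus C (g \<cdot> f) (g \<cdot> f')"
    and Comp_Scale_left:
      "\<lbrakk>A \<in> Obj C; B \<in> Obj C; D \<in> Obj C; f \<in> Hom C A B; g \<in> Hom C B D\<rbrakk>
        \<Longrightarrow> Scale C c g \<cdot> f = Scale C c (g \<cdot> f)"
    and Comp_Scale_right:
      "\<lbrakk>A \<in> Obj C; B \<in> Obj C; D \<in> Obj C; f \<in> Hom C A B; g \<in> Hom C B D\<rbrakk>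
        \<Longrightarrow> g \<cdot> Scale C c f = Scale C c (g \<cdot> f)"

definition linear_functor ::
  "('o1, 'm1, 'k::field, 'z1) lincat_scheme \<Rightarrow> ('o2, 'm2, 'k, 'z2) lincat_scheme \<Rightarrow>
   ('o1, 'm1, 'o2, 'm2) fctr \<Rightarrow> bool" where
  "linear_functor C D F \<longleftrightarrow> is_functor C D F \<and>
     (\<forall>A \<in> Obj C. \<forall>B \<in> Obj C. linear_map (class_ring :: 'k ring)
        (hom_space C A B) (hom_space D (OMap F A) (OMap F B)) (MMap F))"

definition zero_object :: "('o, 'm, 'k, 'z) lincat_scheme \<Rightarrow> 'o \<Rightarrow> bool" where
  "zero_object C N \<longleftrightarrow> N \<in> Obj C \<and>
     (\<forall>A \<in> Obj C. (\<exists>!f. f \<in> Hom C A N) \<and> (\<exists>!f. f \<in> Hom C N A))"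

definition biproduct ::
  "('o, 'm, 'k, 'z) lincat_scheme \<Rightarrow> 'o \<Rightarrow> 'o \<Rightarrow> 'o \<Rightarrow> 'm \<Rightarrow> 'm \<Rightarrow> 'm \<Rightarrow> 'm \<Rightarrow> bool" where
  "biproduct C A B S i j p q \<longleftrightarrow> S \<in> Obj C \<and>
     i \<in> Hom C A S \<and> j \<in> Hom C B S \<and> p \<in> Hom C S A \<and> q \<in> Hom C S B \<and>
     p \<cdot>\<^bsub>C\<^esub> i = Ident C A \<and> q \<cdot>\<^bsub>C\<^esub> j = Ident C B \<and>
     p \<cdot>\<^bsub>C\<^esub> j = Zero C B A \<and> q \<cdot>\<^bsub>C\<^esub> i = Zero C A B \<and>
     Plus C (i \<cdot>\<^bsub>C\<^esub> p) (j \<cdot>\<^bsub>C\<^esub> q) = Ident C S"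

locale additive_category = linear_category +
  assumes has_zero_object: "\<exists>N. zero_object C N"
    and has_biproducts:
      "\<lbrakk>A \<in> Obj C; B \<in> Obj C\<rbrakk> \<Longrightarrow> \<exists>S i j p q. biproduct C A B S i j p q"

section \<open>Triangulated categories\<close>

text \<open>The shift \<open>[1]\<close> is a strict automorphism, with inverse \<open>[-1]\<close>.  A triangle
  \<open>X \<rightarrow> Y \<rightarrow> Z \<rightarrow> X[1]\<close> is recorded as the triple of its morphisms; only triples whose
  morphisms have matching ends in the category count, see \<open>dist_tri\<close>.\<close>

record ('o, 'm, 'k) tricat = "('o, 'm, 'k) lincat" +
  Shift :: "('o, 'm, 'o, 'm) fctr"
  Triangles :: "('m \<times> 'm \<times> 'm) set"

abbreviation shO :: "('o, 'm, 'k, 'z) tricat_scheme \<Rightarrow> 'o \<Rightarrow> 'o" where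
  "shO C \<equiv> OMap (Shift C)"

abbreviation shM :: "('o, 'm, 'k, 'z) tricat_scheme \<Rightarrow> 'm \<Rightarrow> 'm" where
  "shM C \<equiv> MMap (Shift C)"

definition unshO :: "('o, 'm, 'k, 'z) tricat_scheme \<Rightarrow> 'o \<Rightarrow> 'o" where
  "unshO C = inv_into (Obj C) (shO C)"

definition shift_by :: "('o, 'm, 'k, 'z) tricat_scheme \<Rightarrow> int \<Rightarrow> 'o \<Rightarrow> 'o" where
  "shift_by C i X = (if i \<ge> 0 then (shO C ^^ nat i) X else (unshO C ^^ nat (- i)) X)"

definition triangle ::
  "('o, 'm, 'k, 'z) tricat_scheme \<Rightarrow> 'o \<Rightarrow> 'o \<Rightarrow> 'o \<Rightarrow> 'm \<Rightarrow> 'm \<Rightarrow> 'm \<Rightarrow> bool" where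
  "triangle C X Y Z u v w \<longleftrightarrow> X \<in> Obj C \<and> Y \<in> Obj C \<and> Z \<in> Obj C \<and>
     u \<in> Hom C X Y \<and> v \<in> Hom C Y Z \<and> w \<in> Hom C Z (shO C X)"

definition dist_tri ::
  "('o, 'm, 'k, 'z) tricat_scheme \<Rightarrow> 'o \<Rightarrow> 'o \<Rightarrow> 'o \<Rightarrow> 'm \<Rightarrow> 'm \<Rightarrow> 'm \<Rightarrow> bool" where
  "dist_tri C X Y Z u v w \<longleftrightarrow> triangle C X Y Z u v w \<and> (u, v, w) \<in> Triangles C"

definition tri_isomorphic ::
  "('o, 'm, 'k, 'z) tricat_scheme \<Rightarrow>
   'o \<Rightarrow> 'o \<Rightarrow> 'o \<Rightarrow> 'm \<Rightarrow> 'm \<Rightarrow> 'm \<Rightarrow> 'o \<Rightarrow> 'o \<Rightarrow> 'o \<Rightarrow> 'm \<Rightarrow> 'm \<Rightarrow> 'm \<Rightarrow> bool" where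
  "tri_isomorphic C X Y Z u v w X' Y' Z' u' v' w' \<longleftrightarrow>
     triangle C X Y Z u v w \<and> triangle C X' Y' Z' u' v' w' \<and>
     (\<exists>f g h. iso_arr C X X' f \<and> iso_arr C Y Y' g \<and> iso_arr C Z Z' h \<and>
        g \<cdot>\<^bsub>C\<^esub> u = u' \<cdot>\<^bsub>C\<^esub> f \<and> h \<cdot>\<^bsub>C\<^esub> v = v' \<cdot>\<^bsub>C\<^esub> g \<and> shM C f \<cdot>\<^bsub>C\<^esub> w = w' \<cdot>\<^bsub>C\<^esub> h)"

locale triangulated_category = additive_category C
  for C :: "('o, 'm, 'k::field, 'z) tricat_scheme" (structure) +
  assumes Shift_linear: "linear_functor C C (Shift C)"
    and Shift_bij_Obj: "bij_betw (shO C) (Obj C) (Obj C)"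
    and Shift_fully_faithful: "fully_faithful C C (Shift C)"
    and TR1_Ident:
      "\<lbrakk>X \<in> Obj C; zero_object C N\<rbrakk>
        \<Longrightarrow> dist_tri C X X N (Ident C X) (Zero C X N) (Zero C N (shO C X))"
    and TR1_cone:
      "\<lbrakk>X \<in> Obj C; Y \<in> Obj C; u \<in> Hom C X Y\<rbrakk> \<Longrightarrow> \<exists>Z v w. dist_tri C X Y Z u v w"
    and TR1_iso:
      "\<lbrakk>dist_tri C X Y Z u v w; tri_isomorphic C X Y Z u v w X' Y' Z' u' v' w'\<rbrakk>
        \<Longrightarrow> dist_tri C X' Y' Z' u' v' w'"
    and TR2:
      "triangle C X Y Z u v w \<Longrightarrow>
        dist_tri C X Y Z u v w \<longleftrightarrow> dist_tri C Y Z (shO C X) v w (Scale C (- 1) (shM C u))"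
    and TR3:
      "\<lbrakk>dist_tri C X Y Z u v w; dist_tri C X' Y' Z' u' v' w';
        f \<in> Hom C X X'; g \<in> Hom C Y Y'; g \<cdot> u = u' \<cdot> f\<rbrakk>
        \<Longrightarrow> \<exists>h \<in> Hom C Z Z'. h \<cdot> v = v' \<cdot> g \<and> shM C f \<cdot> w = w' \<cdot> h"
    and TR4:
      "\<lbrakk>dist_tri C X Y Z' u j k; dist_tri C Y Z X' v l i; dist_tri C X Z Y' (v \<cdot> u) m n\<rbrakk>
        \<Longrightarrow> \<exists>f \<in> Hom C Z' Y'. \<exists>g \<in> Hom C Y' X'.
              dist_tri C Z' Y' X' f g (shM C j \<cdot> i) \<and>
              f \<cdot> j = m \<cdot> v \<and> n \<cdot> f = k \<and> g \<cdot> m = l \<and> i \<cdot> g = shM C u \<cdot> n"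

definition exact_functor ::
  "('o1, 'm1, 'k, 'z1) tricat_scheme \<Rightarrow> ('o2, 'm2, 'k, 'z2) tricat_scheme \<Rightarrow>
   ('o1, 'm1, 'o2, 'm2) fctr \<Rightarrow> bool" where
  "exact_functor C D F \<longleftrightarrow> is_functor C D F \<and>
     (\<exists>\<eta>. nat_iso C D (comp_fctr F (Shift C)) (comp_fctr (Shift D) F) \<eta> \<and>
       (\<forall>X Y Z u v w. dist_tri C X Y Z u v w \<longrightarrow>
          dist_tri D (OMap F X) (OMap F Y) (OMap F Z) (MMap F u) (MMap F v) (\<eta> X \<cdot>\<^bsub>D\<^esub> MMap F w)))"

definition linear_exact_equivalence ::
  "('o1, 'm1, 'k::field, 'z1) tricat_scheme \<Rightarrow> ('o2, 'm2, 'k, 'z2) tricat_scheme \<Rightarrow>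
   ('o1, 'm1, 'o2, 'm2) fctr \<Rightarrow> bool" where
  "linear_exact_equivalence C D F \<longleftrightarrow>
     linear_functor C D F \<and> exact_functor C D F \<and> equivalence C D F"

section \<open>Triangulated subcategories\<close>

text \<open>Full subcategories are represented by their sets of objects, so that their partial order
  is inclusion.  In \<open>full_subcat\<close> the shift and the triangles need no restriction, because
  every use of them is guarded by membership in \<open>Obj\<close>.\<close>

definition full_subcat :: "('o, 'm, 'z) cat_scheme \<Rightarrow> 'o set \<Rightarrow> ('o, 'm, 'z) cat_scheme" where
  "full_subcat T B = T\<lparr>Obj := B\<rparr>"

definition triangulated_subcategory :: "('o, 'm, 'k, 'z) tricat_scheme \<Rightarrow> 'o set \<Rightarrow> bool" where
  "triangulated_subcategory T B \<longleftrightarrow> B \<noteq> {} \<and> B \<subseteq> Obj T \<and>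
     (\<forall>X \<in> B. shO T X \<in> B) \<and> (\<forall>X \<in> B. unshO T X \<in> B) \<and>
     (\<forall>X Y Z u v w. dist_tri T X Y Z u v w \<and> X \<in> B \<and> Z \<in> B \<longrightarrow> Y \<in> B)"

definition generated :: "('o, 'm, 'k, 'z) tricat_scheme \<Rightarrow> 'o \<Rightarrow> 'o set" where
  "generated T E = \<Inter>{B. triangulated_subcategory T B \<and> E \<in> B}"

definition image_subcat ::
  "('o2, 'm2, 'z) cat_scheme \<Rightarrow> ('o1, 'm1, 'o2, 'm2) fctr \<Rightarrow> 'o1 set \<Rightarrow> 'o2 set" where
  "image_subcat T2 F B = {X \<in> Obj T2. \<exists>A \<in> B. isomorphic T2 X (OMap F A)}"

section \<open>The set C, the graph G and the simplicial complex SC\<close>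

definition pairwise_nonequivalent :: "('o, 'm, 'k::field) tricat set \<Rightarrow> bool" where
  "pairwise_nonequivalent J \<longleftrightarrow>
     (\<forall>A \<in> J. \<forall>A' \<in> J. A \<noteq> A' \<longrightarrow> \<not> (\<exists>\<Phi>. linear_exact_equivalence A A' \<Phi>))"

definition C_set ::
  "('oj, 'mj, 'k::field) tricat set \<Rightarrow> ('o, 'm, 'k) tricat \<Rightarrow> 'o set set" where
  "C_set J T = {B. triangulated_subcategory T B \<and>
     (\<exists>A \<in> J. \<exists>\<Phi>. linear_exact_equivalence A (full_subcat T B) \<Phi>)}"

definition G_graph ::
  "('oj, 'mj, 'k::field) tricat set \<Rightarrow> ('o, 'm, 'k) tricat \<Rightarrow> 'o set pair_pre_digraph" where
  "G_graph J T = \<lparr>pverts = C_set J T,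
     parcs = {(B1, B2). B1 \<in> C_set J T \<and> B2 \<in> C_set J T \<and> B1 \<noteq> B2 \<and>
       (\<forall>X2 \<in> B2. \<forall>X1 \<in> B1. Hom T X2 X1 = {Zero T X2 X1})}\<rparr>"

definition SC_simplices ::
  "('oj, 'mj, 'k::field) tricat set \<Rightarrow> ('o, 'm, 'k) tricat \<Rightarrow> 'o set set set" where
  "SC_simplices J T = {set xs | xs. xs \<noteq> [] \<and> distinct xs \<and> set xs \<subseteq> C_set J T \<and>
     (\<forall>i j. i < j \<and> j < length xs \<longrightarrow> (xs ! i, xs ! j) \<in> parcs (G_graph J T))}"

definition one_sided_edge ::
  "('oj, 'mj, 'k::field) tricat set \<Rightarrow> ('o, 'm, 'k) tricat \<Rightarrow> 'o set \<Rightarrow> 'o set \<Rightarrow> bool" where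
  "one_sided_edge J T a b \<longleftrightarrow>
     (a, b) \<in> parcs (G_graph J T) \<and> (b, a) \<notin> parcs (G_graph J T)"

section \<open>Exceptional objects and the number attached to a one-sided edge\<close>

text \<open>\<open>Hom(E, E)\<close> is the field: every endomorphism is a unique multiple of the identity.\<close>

definition exceptional :: "('o, 'm, 'k::field, 'z) tricat_scheme \<Rightarrow> 'o \<Rightarrow> bool" where
  "exceptional T E \<longleftrightarrow> E \<in> Obj T \<and>
     bij_betw (\<lambda>c. Scale T c (Ident T E)) UNIV (Hom T E E) \<and>
     (\<forall>i. i \<noteq> 0 \<longrightarrow> Hom T E (shift_by T i E) = {Zero T E (shift_by T i E)})"

text \<open>No finiteness of the Hom spaces is assumed, so the sum is taken in \<open>enat\<close>, where every
  family is summable.\<close>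

definition is_edge_number ::
  "('o, 'm, 'k::field) tricat \<Rightarrow> 'o set \<Rightarrow> 'o set \<Rightarrow> enat \<Rightarrow> bool" where
  "is_edge_number T a b n \<longleftrightarrow>
     (\<exists>X Y. exceptional T X \<and> exceptional T Y \<and> a = generated T X \<and> b = generated T Y \<and>
        n = (\<Sum>\<^sub>\<infinity> i \<in> (UNIV :: int set). hom_dim T X (shift_by T i Y)))"

definition edge_number :: "('o, 'm, 'k::field) tricat \<Rightarrow> 'o set \<Rightarrow> 'o set \<Rightarrow> enat" where
  "edge_number T a b = (THE n. is_edge_number T a b n)"

section \<open>Bounded complexes of finite dimensional vector spaces\<close>

text \<open>Finite dimensional vector spaces over \<open>'k\<close> are represented by the coordinate spaces
  \<open>carrier_vec n\<close>, and linear maps by matrices.  Complexes are graded cohomologically.\<close>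

record 'k complex_vs =
  cdim :: "int \<Rightarrow> nat"
  cdiff :: "int \<Rightarrow> 'k mat"

type_synonym 'k cmap = "int \<Rightarrow> 'k mat"

definition bounded_complex :: "'k::field complex_vs \<Rightarrow> bool" where
  "bounded_complex X \<longleftrightarrow>
     (\<forall>i. cdiff X i \<in> carrier_mat (cdim X (i + 1)) (cdim X i)) \<and>
     (\<forall>i. cdiff X (i + 1) * cdiff X i = 0\<^sub>m (cdim X (i + 2)) (cdim X i)) \<and>
     finite {i. cdim X i \<noteq> 0}"

definition chain_map :: "'k::field complex_vs \<Rightarrow> 'k complex_vs \<Rightarrow> 'k cmap \<Rightarrow> bool" where
  "chain_map X Y f \<longleftrightarrow>
     (\<forall>i. f i \<in> carrier_mat (cdim Y i) (cdim X i)) \<and>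
     (\<forall>i. cdiff Y i * f i = f (i + 1) * cdiff X i)"

definition cm_id :: "'k::field complex_vs \<Rightarrow> 'k cmap" where
  "cm_id X = (\<lambda>i. 1\<^sub>m (cdim X i))"

definition cm_zero :: "'k::field complex_vs \<Rightarrow> 'k complex_vs \<Rightarrow> 'k cmap" where
  "cm_zero X Y = (\<lambda>i. 0\<^sub>m (cdim Y i) (cdim X i))"

definition cm_comp :: "'k::field cmap \<Rightarrow> 'k cmap \<Rightarrow> 'k cmap" where
  "cm_comp g f = (\<lambda>i. g i * f i)"

definition homotopic :: "'k::field complex_vs \<Rightarrow> 'k complex_vs \<Rightarrow> 'k cmap \<Rightarrow> 'k cmap \<Rightarrow> bool" where
  "homotopic X Y f g \<longleftrightarrow>
     (\<exists>h. (\<forall>i. h i \<in> carrier_mat (cdim Y (i - 1)) (cdim X i)) \<and>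
          (\<forall>i. f i - g i = cdiff Y (i - 1) * h i + h (i + 1) * cdiff X i))"

definition cocycles :: "'k::field complex_vs \<Rightarrow> int \<Rightarrow> 'k vec set" where
  "cocycles X i = {x \<in> carrier_vec (cdim X i). cdiff X i *\<^sub>v x = 0\<^sub>v (cdim X (i + 1))}"

definition coboundaries :: "'k::field complex_vs \<Rightarrow> int \<Rightarrow> 'k vec set" where
  "coboundaries X i = {cdiff X (i - 1) *\<^sub>v y | y. y \<in> carrier_vec (cdim X (i - 1))}"

definition cohomologous :: "'k::field complex_vs \<Rightarrow> int \<Rightarrow> 'k vec rel" where
  "cohomologous X i = {(x, y). x \<in> cocycles X i \<and> y \<in> cocycles X i \<and> x - y \<in> coboundaries X i}"

definition cohomology :: "'k::field complex_vs \<Rightarrow> int \<Rightarrow> 'k vec set set" where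
  "cohomology X i = cocycles X i // cohomologous X i"

definition cohomology_map ::
  "'k::field complex_vs \<Rightarrow> 'k cmap \<Rightarrow> int \<Rightarrow> 'k vec set \<Rightarrow> 'k vec set" where
  "cohomology_map Y f i c = (\<Union>x\<in>c. cohomologous Y i `` {f i *\<^sub>v x})"

definition quasi_iso :: "'k::field complex_vs \<Rightarrow> 'k complex_vs \<Rightarrow> 'k cmap \<Rightarrow> bool" where
  "quasi_iso X Y f \<longleftrightarrow> chain_map X Y f \<and>
     (\<forall>i. bij_betw (cohomology_map Y f i) (cohomology X i) (cohomology Y i))"

definition shift_complex :: "'k::field complex_vs \<Rightarrow> 'k complex_vs" where
  "shift_complex X = \<lparr>cdim = (\<lambda>i. cdim X (i + 1)), cdiff = (\<lambda>i. - cdiff X (i + 1))\<rparr>"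

definition shift_cmap :: "'k cmap \<Rightarrow> 'k cmap" where
  "shift_cmap f = (\<lambda>i. f (i + 1))"

text \<open>The mapping cone is \<open>X[1] \<oplus> Y\<close> with the differential twisted by \<open>f\<close>.\<close>

definition cone :: "'k::field complex_vs \<Rightarrow> 'k complex_vs \<Rightarrow> 'k cmap \<Rightarrow> 'k complex_vs" where
  "cone X Y f = \<lparr>cdim = (\<lambda>i. cdim X (i + 1) + cdim Y i),
     cdiff = (\<lambda>i. four_block_mat (- cdiff X (i + 1)) (0\<^sub>m (cdim X (i + 2)) (cdim Y i))
                                 (f (i + 1)) (cdiff Y i))\<rparr>"

definition cone_in :: "'k::field complex_vs \<Rightarrow> 'k complex_vs \<Rightarrow> 'k cmap" where
  "cone_in X Y = (\<lambda>i. mat (cdim X (i + 1) + cdim Y i) (cdim Y i)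
     (\<lambda>(r, c). if r = cdim X (i + 1) + c then 1 else 0))"

definition cone_out :: "'k::field complex_vs \<Rightarrow> 'k complex_vs \<Rightarrow> 'k cmap" where
  "cone_out X Y = (\<lambda>i. mat (cdim X (i + 1)) (cdim X (i + 1) + cdim Y i)
     (\<lambda>(r, c). if r = c then 1 else 0))"

section \<open>The bounded derived category of finite dimensional vector spaces\<close>

text \<open>The bounded derived category is the localization of the homotopy category of bounded
  complexes at the quasi-isomorphisms.  A roof \<open>(Z, s, f)\<close> stands for \<open>X \<leftarrow> Z \<rightarrow> Y\<close>, the
  fraction of \<open>f\<close> by the quasi-isomorphism \<open>s\<close>.  A morphism is an equivalence class of roofs
  together with its domain and codomain.\<close>

type_synonym 'k roof = "'k complex_vs \<times> 'k cmap \<times> 'k cmap"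
type_synonym 'k dmor = "'k complex_vs \<times> 'k complex_vs \<times> 'k roof set"

definition roofs :: "'k::field complex_vs \<Rightarrow> 'k complex_vs \<Rightarrow> 'k roof set" where
  "roofs X Y = {(Z, s, f). bounded_complex Z \<and> quasi_iso Z X s \<and> chain_map Z Y f}"

definition roof_equiv :: "'k::field complex_vs \<Rightarrow> 'k complex_vs \<Rightarrow> 'k roof rel" where
  "roof_equiv X Y = {((Z, s, f), (Z', s', f')).
     (Z, s, f) \<in> roofs X Y \<and> (Z', s', f') \<in> roofs X Y \<and>
     (\<exists>W t t'. bounded_complex W \<and> chain_map W Z t \<and> chain_map W Z' t' \<and>
        quasi_iso W X (cm_comp s t) \<and>
        homotopic W X (cm_comp s t) (cm_comp s' t') \<and>
        homotopic W Y (cm_comp f t) (cm_comp f' t'))}"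

definition D_class :: "'k::field complex_vs \<Rightarrow> 'k complex_vs \<Rightarrow> 'k roof \<Rightarrow> 'k dmor" where
  "D_class X Y r = (X, Y, roof_equiv X Y `` {r})"

definition D_of_chain :: "'k::field complex_vs \<Rightarrow> 'k complex_vs \<Rightarrow> 'k cmap \<Rightarrow> 'k dmor" where
  "D_of_chain X Y f = D_class X Y (X, cm_id X, f)"

definition D_hom :: "'k::field complex_vs \<Rightarrow> 'k complex_vs \<Rightarrow> 'k dmor set" where
  "D_hom X Y = {(X, Y, R) | R. R \<in> roofs X Y // roof_equiv X Y}"

text \<open>Roofs are composed by completing \<open>Z \<rightarrow> Y \<leftarrow> Z'\<close> to a square commuting up to homotopy.\<close>

definition D_comp :: "'k::field dmor \<Rightarrow> 'k dmor \<Rightarrow> 'k dmor" where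
  "D_comp = (\<lambda>(_, Y', R') (X, Y, R).
     (X, Y', \<Union>{roof_equiv X Y' `` {(W, cm_comp s t, cm_comp g t')} | Z s f Z' s' g W t t'.
        (Z, s, f) \<in> R \<and> (Z', s', g) \<in> R' \<and> bounded_complex W \<and>
        quasi_iso W Z t \<and> chain_map W Z' t' \<and> homotopic W Y (cm_comp f t) (cm_comp s' t')}))"

text \<open>Two classes are added by means of representatives with a common denominator.\<close>

definition D_plus :: "'k::field dmor \<Rightarrow> 'k dmor \<Rightarrow> 'k dmor" where
  "D_plus = (\<lambda>(X, Y, R) (_, _, R').
     (X, Y, \<Union>{roof_equiv X Y `` {(Z, s, \<lambda>i. f i + g i)} | Z s f g. (Z, s, f) \<in> R \<and> (Z, s, g) \<in> R'}))"

definition D_scale :: "'k::field \<Rightarrow> 'k dmor \<Rightarrow> 'k dmor" where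
  "D_scale c = (\<lambda>(X, Y, R).
     (X, Y, \<Union>{roof_equiv X Y `` {(Z, s, \<lambda>i. c \<cdot>\<^sub>m f i)} | Z s f. (Z, s, f) \<in> R}))"

definition D_shift :: "'k::field dmor \<Rightarrow> 'k dmor" where
  "D_shift = (\<lambda>(X, Y, R). (shift_complex X, shift_complex Y,
     \<Union>{roof_equiv (shift_complex X) (shift_complex Y) ``
          {(shift_complex Z, shift_cmap s, shift_cmap f)} | Z s f. (Z, s, f) \<in> R}))"

text \<open>The structure without distinguished triangles, which serves to say which triangles are
  isomorphic to that of a mapping cone.\<close>

definition Db_pre :: "('k::field complex_vs, 'k dmor, 'k) tricat" where
  "Db_pre = \<lparr>Obj = {X. bounded_complex X}, Hom = D_hom,
     Ident = (\<lambda>X. D_of_chain X X (cm_id X)), Comp = D_comp,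
     Zero = (\<lambda>X Y. D_of_chain X Y (cm_zero X Y)), Plus = D_plus, Scale = D_scale,
     Shift = \<lparr>OMap = shift_complex, MMap = D_shift\<rparr>, Triangles = {}\<rparr>"

definition Db_A1 :: "('k::field complex_vs, 'k dmor, 'k) tricat" where
  "Db_A1 = Db_pre\<lparr>Triangles := {(u, v, w). \<exists>X Y Z A B f.
     bounded_complex A \<and> bounded_complex B \<and> chain_map A B f \<and>
     tri_isomorphic Db_pre
       A B (cone A B f)
       (D_of_chain A B f) (D_of_chain B (cone A B f) (cone_in A B))
       (D_of_chain (cone A B f) (shift_complex A) (cone_out A B))
       X Y Z u v w}\<rparr>"

end

theory Submission
  imports Defs
begin

text \<open>All of the structure in question is expressed through triangulated subcategories and Hom
  spaces, and \<open>F\<close> preserves both.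

  Let \<open>B\<close> be a triangulated subcategory of the source.  Its image is triangulated because it is
  closed under shifts and cones: a morphism between objects of the image is, up to isomorphism,
  \<open>F a\<close> for a morphism \<open>a\<close> of \<open>B\<close>; then \<open>F\<close> maps a cone of \<open>a\<close> to a cone of \<open>F a\<close>, and cones of
  isomorphic morphisms are isomorphic (\<open>triangulated_subcategory_image\<close>, \<open>cone_unique\<close>).  The
  restriction of \<open>F\<close> to \<open>B\<close> is a linear exact equivalence onto the image, being fully faithful and
  essentially surjective; composed with an equivalence from a member of \<open>J\<close> to \<open>B\<close> it shows that
  the image is a vertex (\<open>image_subcat_in_C_set\<close>).

  Since \<open>F\<close> reflects isomorphism and triangulated subcategories are closed under isomorphism, the
  inclusion of images is equivalent to the inclusion of the subcategories
  (\<open>image_subcat_subset_iff\<close>).  This gives injectivity and the statement on the order.  If \<open>F X\<close> is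
  isomorphic to \<open>X'\<close> and \<open>F Y\<close> to \<open>Y'\<close>, then \<open>Hom(X, Y)\<close> and \<open>Hom(X', Y')\<close> are isomorphic
  vector spaces (\<open>hom_iso_exists\<close>).  Hence one of them vanishes if and only if the other does, which
  settles edges and simplices.

  For the numbers, the same comparison of Hom spaces identifies exceptional objects and the dimensions
  of \<open>Hom(X, Y[i])\<close>, and the image of the subcategory generated by \<open>E\<close> is generated by \<open>F E\<close>
  (\<open>image_subcat_generated\<close>).\<close>

section \<open>Isomorphisms in a category\<close>

context category
begin

lemma cancel_left:
  assumes "A \<in> Obj C" "B \<in> Obj C" "D \<in> Obj C"
    and "f \<in> Hom C A B" "g \<in> Hom C B D" "g' \<in> Hom C D B" "g' \<cdot> g = Ident C B"
  shows "g' \<cdot> (g \<cdot> f) = f"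
  using assms Comp_assoc[of A B D B f g g'] Ident_left[of A B f] by simp

lemma cancel_right:
  assumes "A \<in> Obj C" "B \<in> Obj C" "D \<in> Obj C"
    and "f \<in> Hom C A B" "f' \<in> Hom C B A" "h \<in> Hom C A D" "f' \<cdot> f = Ident C A"
  shows "(h \<cdot> f') \<cdot> f = h"
  using assms Comp_assoc[of A B A D f f' h] Ident_right[of A D h] by simp

lemma iso_arr_inverse:
  assumes "iso_arr C A B f"
  obtains g where "iso_arr C B A g" "g \<cdot> f = Ident C A" "f \<cdot> g = Ident C B"
  using assms unfolding iso_arr_def by blast

lemma iso_arr_left_right_inverse:
  assumes "A \<in> Obj C" "B \<in> Obj C"
    and "f \<in> Hom C A B" "g \<in> Hom C B A" "h \<in> Hom C B A"
    and "g \<cdot> f = Ident C A" "f \<cdot> h = Ident C B"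
  shows "iso_arr C A B f"
proof -
  have "g = h"
    using assms Comp_assoc[of B A B A h f g] Ident_left[of B A h] Ident_right[of B A g] by simp
  then show ?thesis
    using assms by (auto simp: iso_arr_def)
qed

lemma iso_arr_Ident: "A \<in> Obj C \<Longrightarrow> iso_arr C A A (Ident C A)"
  unfolding iso_arr_def using Ident_in_Hom Ident_left by blast

lemma iso_arr_comp:
  assumes f: "iso_arr C A B f" and g: "iso_arr C B D g"
  shows "iso_arr C A D (g \<cdot> f)"
proof -
  obtain f' where f': "iso_arr C B A f'" "f' \<cdot> f = Ident C A" "f \<cdot> f' = Ident C B"
    using f by (rule iso_arr_inverse)
  obtain g' where g': "iso_arr C D B g'" "g' \<cdot> g = Ident C B" "g \<cdot> g' = Ident C D"
    using g by (rule iso_arr_inverse)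
  have O: "A \<in> Obj C" "B \<in> Obj C" "D \<in> Obj C"
    and H: "f \<in> Hom C A B" "g \<in> Hom C B D" "f' \<in> Hom C B A" "g' \<in> Hom C D B"
    using f g f' g' by (auto simp: iso_arr_def)
  have H': "g \<cdot> f \<in> Hom C A D" "f' \<cdot> g' \<in> Hom C D A"
    using O H Comp_in_Hom by blast+
  have "(f' \<cdot> g') \<cdot> (g \<cdot> f) = f' \<cdot> (g' \<cdot> (g \<cdot> f))"
    using O H H' Comp_assoc[of A D B A "g \<cdot> f" g' f'] by simp
  moreover have "(g \<cdot> f) \<cdot> (f' \<cdot> g') = g \<cdot> (f \<cdot> (f' \<cdot> g'))"
    using O H H' Comp_assoc[of D A B D "f' \<cdot> g'" f g] by simp
  ultimately have "(f' \<cdot> g') \<cdot> (g \<cdot> f) = Ident C A" "(g \<cdot> f) \<cdot> (f' \<cdot> g') = Ident C D"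
    using O H f' g' cancel_left[of A B D f g g'] cancel_left[of D B A g' f' f] by simp_all
  then show ?thesis
    using O H' by (auto simp: iso_arr_def)
qed

lemma isomorphic_Obj: "isomorphic C A B \<Longrightarrow> A \<in> Obj C \<and> B \<in> Obj C"
  by (auto simp: isomorphic_def iso_arr_def)

lemma isomorphic_refl: "A \<in> Obj C \<Longrightarrow> isomorphic C A A"
  using iso_arr_Ident by (auto simp: isomorphic_def)

lemma isomorphic_sym: "isomorphic C A B \<Longrightarrow> isomorphic C B A"
  unfolding isomorphic_def using iso_arr_inverse by metis

lemma isomorphic_trans: "isomorphic C A B \<Longrightarrow> isomorphic C B D \<Longrightarrow> isomorphic C A D"
  unfolding isomorphic_def using iso_arr_comp by blast

end

section \<open>Functors and equivalences\<close>

lemma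
  assumes "is_functor C D F"
  shows functor_Obj: "A \<in> Obj C \<Longrightarrow> OMap F A \<in> Obj D"
    and functor_Hom: "A \<in> Obj C \<Longrightarrow> B \<in> Obj C \<Longrightarrow> f \<in> Hom C A B \<Longrightarrow>
      MMap F f \<in> Hom D (OMap F A) (OMap F B)"
    and functor_Ident: "A \<in> Obj C \<Longrightarrow> MMap F (Ident C A) = Ident D (OMap F A)"
    and functor_Comp: "A \<in> Obj C \<Longrightarrow> B \<in> Obj C \<Longrightarrow> E \<in> Obj C \<Longrightarrow> f \<in> Hom C A B \<Longrightarrow>
      g \<in> Hom C B E \<Longrightarrow> MMap F (g \<cdot>\<^bsub>C\<^esub> f) = MMap F g \<cdot>\<^bsub>D\<^esub> MMap F f"
  using assms unfolding is_functor_def by blast+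

lemma functor_iso_arr:
  assumes F: "is_functor C D F" and f: "iso_arr C A B f"
  shows "iso_arr D (OMap F A) (OMap F B) (MMap F f)"
proof -
  obtain g where g: "A \<in> Obj C" "B \<in> Obj C" "f \<in> Hom C A B" "g \<in> Hom C B A"
      "g \<cdot>\<^bsub>C\<^esub> f = Ident C A" "f \<cdot>\<^bsub>C\<^esub> g = Ident C B"
    using f by (auto simp: iso_arr_def)
  have "MMap F g \<cdot>\<^bsub>D\<^esub> MMap F f = Ident D (OMap F A)"
    "MMap F f \<cdot>\<^bsub>D\<^esub> MMap F g = Ident D (OMap F B)"
    using g functor_Comp[OF F] functor_Ident[OF F] by metis+
  then show ?thesis
    using g functor_Obj[OF F] functor_Hom[OF F] unfolding iso_arr_def by blast
qed

lemma functor_isomorphic: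
  "is_functor C D F \<Longrightarrow> isomorphic C A B \<Longrightarrow> isomorphic D (OMap F A) (OMap F B)"
  by (auto simp: isomorphic_def dest: functor_iso_arr)

lemma is_functor_comp:
  assumes "is_functor C D F" "is_functor D E G"
  shows "is_functor C E (comp_fctr G F)"
  using assms unfolding is_functor_def comp_fctr_def by simp blast

lemma fully_faithful_preimage:
  assumes "fully_faithful C D F" "A \<in> Obj C" "B \<in> Obj C" "g \<in> Hom D (OMap F A) (OMap F B)"
  obtains f where "f \<in> Hom C A B" "MMap F f = g"
proof -
  have "g \<in> MMap F ` Hom C A B"
    using assms by (auto simp: fully_faithful_def bij_betw_def)
  then show ?thesis
    using that by blast
qed

lemma fully_faithful_inj:
  assumes "fully_faithful C D F" "A \<in> Obj C" "B \<in> Obj C" "f \<in> Hom C A B" "f' \<in> Hom C A B"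
    and "MMap F f = MMap F f'"
  shows "f = f'"
  using assms unfolding fully_faithful_def bij_betw_def inj_on_def by blast

lemma fully_faithful_reflects_iso_arr:
  assumes C: "category C" and F: "is_functor C D F" and ff: "fully_faithful C D F"
    and f: "A \<in> Obj C" "B \<in> Obj C" "f \<in> Hom C A B"
    and iso: "iso_arr D (OMap F A) (OMap F B) (MMap F f)"
  shows "iso_arr C A B f"
proof -
  interpret category C by (fact C)
  obtain g' where g': "g' \<in> Hom D (OMap F B) (OMap F A)"
      "g' \<cdot>\<^bsub>D\<^esub> MMap F f = Ident D (OMap F A)" "MMap F f \<cdot>\<^bsub>D\<^esub> g' = Ident D (OMap F B)"
    using iso by (auto simp: iso_arr_def)
  obtain g where g: "g \<in> Hom C B A" "MMap F g = g'"
    using fully_faithful_preimage[OF ff f(2) f(1) g'(1)] .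
  have "g \<cdot>\<^bsub>C\<^esub> f = Ident C A"
  proof (rule fully_faithful_inj[OF ff f(1) f(1)])
    show "MMap F (g \<cdot>\<^bsub>C\<^esub> f) = MMap F (Ident C A)"
      using functor_Comp[OF F f(1) f(2) f(1) f(3) g(1)] functor_Ident[OF F f(1)] g' g by simp
  qed (use f g Ident_in_Hom Comp_in_Hom in blast)+
  moreover have "f \<cdot>\<^bsub>C\<^esub> g = Ident C B"
  proof (rule fully_faithful_inj[OF ff f(2) f(2)])
    show "MMap F (f \<cdot>\<^bsub>C\<^esub> g) = MMap F (Ident C B)"
      using functor_Comp[OF F f(2) f(1) f(2) g(1) f(3)] functor_Ident[OF F f(2)] g' g by simp
  qed (use f g Ident_in_Hom Comp_in_Hom in blast)+
  ultimately show ?thesis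
    using f g by (auto simp: iso_arr_def)
qed

lemma fully_faithful_reflects_isomorphic:
  assumes "category C" "is_functor C D F" and ff: "fully_faithful C D F"
    and "A \<in> Obj C" "B \<in> Obj C" "isomorphic D (OMap F A) (OMap F B)"
  shows "isomorphic C A B"
proof -
  obtain g where g: "iso_arr D (OMap F A) (OMap F B) g"
    using assms by (auto simp: isomorphic_def)
  then have "g \<in> Hom D (OMap F A) (OMap F B)"
    by (simp add: iso_arr_def)
  then obtain f where "f \<in> Hom C A B" "MMap F f = g"
    using fully_faithful_preimage assms by metis
  then show ?thesis
    using fully_faithful_reflects_iso_arr[of C D F A B f] assms g by (auto simp: isomorphic_def)
qed

text \<open>A quasi-inverse \<open>G\<close> is obtained by choosing, for every object \<open>Y\<close> of \<open>D\<close>, a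
  preimage \<open>G Y\<close> together with an isomorphism \<open>\<epsilon> Y : F (G Y) \<rightarrow> Y\<close>; the value of \<open>G\<close> on a
  morphism \<open>f\<close> is the preimage under \<open>F\<close> of the conjugate of \<open>f\<close>.  It is well defined because
  a morphism determines its ends.\<close>

lemma equivalence_if_fully_faithful_ess_surj:
  fixes C :: "('o1, 'm1, 'z1) cat_scheme" and D :: "('o2, 'm2, 'z2) cat_scheme"
  assumes C: "category C" and D: "category D"
    and F: "is_functor C D F" and ff: "fully_faithful C D F"
    and surj: "\<And>Y. Y \<in> Obj D \<Longrightarrow> \<exists>X \<in> Obj C. isomorphic D (OMap F X) Y"
  shows "equivalence C D F"
proof -
  interpret C: category C by (fact C)
  interpret D: category D by (fact D)
  have "\<exists>G. \<forall>Y \<in> Obj D. G Y \<in> Obj C \<and> isomorphic D (OMap F (G Y)) Y"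
    using surj by metis
  then obtain G0 where G0: "\<And>Y. Y \<in> Obj D \<Longrightarrow> G0 Y \<in> Obj C"
      "\<And>Y. Y \<in> Obj D \<Longrightarrow> isomorphic D (OMap F (G0 Y)) Y"
    by blast
  then have "\<forall>Y. \<exists>e d. Y \<in> Obj D \<longrightarrow> e \<in> Hom D (OMap F (G0 Y)) Y \<and>
      d \<in> Hom D Y (OMap F (G0 Y)) \<and> d \<cdot>\<^bsub>D\<^esub> e = Ident D (OMap F (G0 Y)) \<and> e \<cdot>\<^bsub>D\<^esub> d = Ident D Y"
    unfolding isomorphic_def iso_arr_def by meson
  then obtain \<epsilon> \<delta> where eps: "\<And>Y. Y \<in> Obj D \<Longrightarrow> \<epsilon> Y \<in> Hom D (OMap F (G0 Y)) Y"
      and del: "\<And>Y. Y \<in> Obj D \<Longrightarrow> \<delta> Y \<in> Hom D Y (OMap F (G0 Y))"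
      and de: "\<And>Y. Y \<in> Obj D \<Longrightarrow> \<delta> Y \<cdot>\<^bsub>D\<^esub> \<epsilon> Y = Ident D (OMap F (G0 Y))"
      and ed: "\<And>Y. Y \<in> Obj D \<Longrightarrow> \<epsilon> Y \<cdot>\<^bsub>D\<^esub> \<delta> Y = Ident D Y"
    by metis
  note FO = functor_Obj[OF F] and FH = functor_Hom[OF F] and FC = functor_Comp[OF F]
  note CO = C.Comp_in_Hom and DO = D.Comp_in_Hom
  define GM where "GM f = (SOME m. \<exists>Y \<in> Obj D. \<exists>Y' \<in> Obj D. f \<in> Hom D Y Y' \<and>
      m \<in> Hom C (G0 Y) (G0 Y') \<and> \<epsilon> Y' \<cdot>\<^bsub>D\<^esub> MMap F m = f \<cdot>\<^bsub>D\<^esub> \<epsilon> Y)" for f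
  \<comment> \<open>The defining property of the quasi-inverse on morphisms is naturality of \<open>\<epsilon>\<close>.\<close>
  have GM: "GM f \<in> Hom C (G0 Y) (G0 Y')" "\<epsilon> Y' \<cdot>\<^bsub>D\<^esub> MMap F (GM f) = f \<cdot>\<^bsub>D\<^esub> \<epsilon> Y"
    if Y: "Y \<in> Obj D" "Y' \<in> Obj D" and f: "f \<in> Hom D Y Y'" for Y Y' f
  proof -
    note O = FO[OF G0(1)[OF Y(1)]] FO[OF G0(1)[OF Y(2)]]
    have h: "f \<cdot>\<^bsub>D\<^esub> \<epsilon> Y \<in> Hom D (OMap F (G0 Y)) Y'"
      using DO[OF O(1) Y eps[OF Y(1)] f] .
    then have "\<delta> Y' \<cdot>\<^bsub>D\<^esub> (f \<cdot>\<^bsub>D\<^esub> \<epsilon> Y) \<in> Hom D (OMap F (G0 Y)) (OMap F (G0 Y'))"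
      using DO[OF O(1) Y(2) O(2) _ del[OF Y(2)]] by blast
    then obtain m where m: "m \<in> Hom C (G0 Y) (G0 Y')" "MMap F m = \<delta> Y' \<cdot>\<^bsub>D\<^esub> (f \<cdot>\<^bsub>D\<^esub> \<epsilon> Y)"
      using fully_faithful_preimage[OF ff G0(1)[OF Y(1)] G0(1)[OF Y(2)]] by blast
    then have "\<epsilon> Y' \<cdot>\<^bsub>D\<^esub> MMap F m = f \<cdot>\<^bsub>D\<^esub> \<epsilon> Y"
      using D.cancel_left[OF O(1) Y(2) O(2) h del[OF Y(2)] eps[OF Y(2)] ed[OF Y(2)]] by simp
    then have "\<exists>m. \<exists>Y \<in> Obj D. \<exists>Y' \<in> Obj D. f \<in> Hom D Y Y' \<and>
        m \<in> Hom C (G0 Y) (G0 Y') \<and> \<epsilon> Y' \<cdot>\<^bsub>D\<^esub> MMap F m = f \<cdot>\<^bsub>D\<^esub> \<epsilon> Y"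
      using Y f m by blast
    then have "\<exists>Y \<in> Obj D. \<exists>Y' \<in> Obj D. f \<in> Hom D Y Y' \<and>
        GM f \<in> Hom C (G0 Y) (G0 Y') \<and> \<epsilon> Y' \<cdot>\<^bsub>D\<^esub> MMap F (GM f) = f \<cdot>\<^bsub>D\<^esub> \<epsilon> Y"
      unfolding GM_def by (rule someI_ex)
    then obtain Z Z' where Z: "Z \<in> Obj D" "Z' \<in> Obj D" "f \<in> Hom D Z Z'"
        "GM f \<in> Hom C (G0 Z) (G0 Z')" "\<epsilon> Z' \<cdot>\<^bsub>D\<^esub> MMap F (GM f) = f \<cdot>\<^bsub>D\<^esub> \<epsilon> Z"
      by blast
    have "Y = Z \<and> Y' = Z'"
      using D.Hom_disjoint[OF Y Z(1,2) f Z(3)] .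
    then show "GM f \<in> Hom C (G0 Y) (G0 Y')" "\<epsilon> Y' \<cdot>\<^bsub>D\<^esub> MMap F (GM f) = f \<cdot>\<^bsub>D\<^esub> \<epsilon> Y"
      using Z by auto
  qed
  have eq: "m = m'"
    if X: "X \<in> Obj C" and Y: "Y \<in> Obj D" and m: "m \<in> Hom C X (G0 Y)" "m' \<in> Hom C X (G0 Y)"
      and e: "\<epsilon> Y \<cdot>\<^bsub>D\<^esub> MMap F m = \<epsilon> Y \<cdot>\<^bsub>D\<^esub> MMap F m'" for X Y m m'
  proof (rule fully_faithful_inj[OF ff X G0(1)[OF Y] m])
    have "\<delta> Y \<cdot>\<^bsub>D\<^esub> (\<epsilon> Y \<cdot>\<^bsub>D\<^esub> MMap F n) = MMap F n" if "n \<in> Hom C X (G0 Y)" for n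
      using D.cancel_left[OF FO[OF X] FO[OF G0(1)[OF Y]] Y FH[OF X G0(1)[OF Y] that]
          eps[OF Y] del[OF Y] de[OF Y]] .
    then show "MMap F m = MMap F m'"
      using e m by metis
  qed
  define G where "G = \<lparr>OMap = G0, MMap = GM\<rparr>"
  have G: "is_functor D C G"
    unfolding is_functor_def G_def fctr.simps
  proof (intro conjI ballI)
    show "G0 Y \<in> Obj C" if "Y \<in> Obj D" for Y
      using that by (rule G0)
    show "GM f \<in> Hom C (G0 Y) (G0 Y')" if "Y \<in> Obj D" "Y' \<in> Obj D" "f \<in> Hom D Y Y'" for Y Y' f
      using that by (rule GM)
    show "GM (Ident D Y) = Ident C (G0 Y)" if Y: "Y \<in> Obj D" for Y
    proof (rule eq[OF G0(1)[OF Y] Y])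
      show "GM (Ident D Y) \<in> Hom C (G0 Y) (G0 Y)"
        using GM Y D.Ident_in_Hom by blast
      show "Ident C (G0 Y) \<in> Hom C (G0 Y) (G0 Y)"
        using G0 Y C.Ident_in_Hom by blast
      show "\<epsilon> Y \<cdot>\<^bsub>D\<^esub> MMap F (GM (Ident D Y)) = \<epsilon> Y \<cdot>\<^bsub>D\<^esub> MMap F (Ident C (G0 Y))"
        using GM(2)[OF Y Y D.Ident_in_Hom[OF Y]] functor_Ident[OF F G0(1)[OF Y]]
          D.Ident_left[OF _ _ eps[OF Y]] D.Ident_right[OF _ _ eps[OF Y]] FO G0 Y by simp
    qed
    show "GM (g \<cdot>\<^bsub>D\<^esub> f) = GM g \<cdot>\<^bsub>C\<^esub> GM f"
      if Y: "Y \<in> Obj D" "Y' \<in> Obj D" "Y'' \<in> Obj D" and f: "f \<in> Hom D Y Y'" and g: "g \<in> Hom D Y' Y''"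
      for Y Y' Y'' f g
    proof (rule eq[OF G0(1)[OF Y(1)] Y(3)])
      note Gf = GM[OF Y(1,2) f] and Gg = GM[OF Y(2,3) g]
      note O = FO[OF G0(1)[OF Y(1)]] FO[OF G0(1)[OF Y(2)]] FO[OF G0(1)[OF Y(3)]]
      have FGf: "MMap F (GM f) \<in> Hom D (OMap F (G0 Y)) (OMap F (G0 Y'))"
        and FGg: "MMap F (GM g) \<in> Hom D (OMap F (G0 Y')) (OMap F (G0 Y''))"
        using FH[OF G0(1)[OF Y(1)] G0(1)[OF Y(2)] Gf(1)]
          FH[OF G0(1)[OF Y(2)] G0(1)[OF Y(3)] Gg(1)] .
      show gf: "GM (g \<cdot>\<^bsub>D\<^esub> f) \<in> Hom C (G0 Y) (G0 Y'')"
        using GM(1)[OF Y(1,3) DO[OF Y f g]] .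
      show "GM g \<cdot>\<^bsub>C\<^esub> GM f \<in> Hom C (G0 Y) (G0 Y'')"
        using CO[OF G0(1)[OF Y(1)] G0(1)[OF Y(2)] G0(1)[OF Y(3)] Gf(1) Gg(1)] .
      have "\<epsilon> Y'' \<cdot>\<^bsub>D\<^esub> MMap F (GM g \<cdot>\<^bsub>C\<^esub> GM f) = \<epsilon> Y'' \<cdot>\<^bsub>D\<^esub> (MMap F (GM g) \<cdot>\<^bsub>D\<^esub> MMap F (GM f))"
        using FC[OF G0(1)[OF Y(1)] G0(1)[OF Y(2)] G0(1)[OF Y(3)] Gf(1) Gg(1)] by simp
      also have "\<dots> = (\<epsilon> Y'' \<cdot>\<^bsub>D\<^esub> MMap F (GM g)) \<cdot>\<^bsub>D\<^esub> MMap F (GM f)"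
        using D.Comp_assoc[OF O Y(3) FGf FGg eps[OF Y(3)]] by simp
      also have "\<dots> = (g \<cdot>\<^bsub>D\<^esub> \<epsilon> Y') \<cdot>\<^bsub>D\<^esub> MMap F (GM f)"
        using Gg by simp
      also have "\<dots> = g \<cdot>\<^bsub>D\<^esub> (f \<cdot>\<^bsub>D\<^esub> \<epsilon> Y)"
        using D.Comp_assoc[OF O(1,2) Y(2,3) FGf eps[OF Y(2)] g] Gf by simp
      also have "\<dots> = (g \<cdot>\<^bsub>D\<^esub> f) \<cdot>\<^bsub>D\<^esub> \<epsilon> Y"
        using D.Comp_assoc[OF O(1) Y eps[OF Y(1)] f g] by simp
      also have "\<dots> = \<epsilon> Y'' \<cdot>\<^bsub>D\<^esub> MMap F (GM (g \<cdot>\<^bsub>D\<^esub> f))"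
        using GM(2)[OF Y(1,3) DO[OF Y f g]] by simp
      finally show "\<epsilon> Y'' \<cdot>\<^bsub>D\<^esub> MMap F (GM (g \<cdot>\<^bsub>D\<^esub> f)) = \<epsilon> Y'' \<cdot>\<^bsub>D\<^esub> MMap F (GM g \<cdot>\<^bsub>C\<^esub> GM f)"
        by simp
    qed
  qed
  have eps_iso: "iso_arr D (OMap F (G0 Y)) Y (\<epsilon> Y)" if "Y \<in> Obj D" for Y
    using that eps del de ed FO G0 unfolding iso_arr_def by blast
  have counit: "nat_iso D D (comp_fctr F G) id_fctr \<epsilon>"
    unfolding nat_iso_def comp_fctr_def id_fctr_def G_def using eps_iso GM by simp
  have "\<forall>X. \<exists>e. X \<in> Obj C \<longrightarrow> e \<in> Hom C (G0 (OMap F X)) X \<and> MMap F e = \<epsilon> (OMap F X)"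
    using fully_faithful_preimage[OF ff] G0 FO eps by metis
  then obtain \<eta> where eta: "\<And>X. X \<in> Obj C \<Longrightarrow> \<eta> X \<in> Hom C (G0 (OMap F X)) X"
      "\<And>X. X \<in> Obj C \<Longrightarrow> MMap F (\<eta> X) = \<epsilon> (OMap F X)"
    by metis
  have "nat_iso C C (comp_fctr G F) id_fctr \<eta>"
    unfolding nat_iso_def comp_fctr_def id_fctr_def G_def fctr.simps
  proof (intro conjI ballI)
    show "iso_arr C (G0 (OMap F X)) X (\<eta> X)" if X: "X \<in> Obj C" for X
      by (rule fully_faithful_reflects_iso_arr[OF C F ff]) (use X eta G0 FO eps_iso in simp_all)
    show "\<eta> X' \<cdot>\<^bsub>C\<^esub> GM (MMap F f) = f \<cdot>\<^bsub>C\<^esub> \<eta> X"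
      if X: "X \<in> Obj C" "X' \<in> Obj C" and f: "f \<in> Hom C X X'" for X X' f
    proof (rule fully_faithful_inj[OF ff G0(1)[OF FO[OF X(1)]] X(2)])
      note g = GM[OF FO[OF X(1)] FO[OF X(2)] FH[OF X f]]
      note O = G0(1)[OF FO[OF X(1)]] G0(1)[OF FO[OF X(2)]]
      show "\<eta> X' \<cdot>\<^bsub>C\<^esub> GM (MMap F f) \<in> Hom C (G0 (OMap F X)) X'"
        using CO[OF O X(2) g(1) eta(1)[OF X(2)]] .
      show "f \<cdot>\<^bsub>C\<^esub> \<eta> X \<in> Hom C (G0 (OMap F X)) X'"
        using CO[OF O(1) X eta(1)[OF X(1)] f] .
      show "MMap F (\<eta> X' \<cdot>\<^bsub>C\<^esub> GM (MMap F f)) = MMap F (f \<cdot>\<^bsub>C\<^esub> \<eta> X)"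
        using FC[OF O X(2) g(1) eta(1)[OF X(2)]] FC[OF O(1) X eta(1)[OF X(1)] f] eta(2) X g(2)
        by simp
    qed
  qed
  then show ?thesis
    unfolding equivalence_def using F G counit by blast
qed

text \<open>The isomorphism \<open>G P F \<rightarrow> G F \<rightarrow> 1\<close>.  It is used twice for a composite of equivalences:
  for the unit \<open>P\<close> is the composite of the second functor with its quasi-inverse, for the counit
  that of the first.\<close>

lemma nat_iso_sandwich:
  assumes C: "category C" and F: "is_functor C D F" and G: "is_functor D C G"
    and P: "is_functor D D P"
    and \<alpha>: "nat_iso D D P id_fctr \<alpha>" and \<beta>: "nat_iso C C (comp_fctr G F) id_fctr \<beta>"
  shows "nat_iso C C (comp_fctr G (comp_fctr P F)) id_fctr
    (\<lambda>A. \<beta> A \<cdot>\<^bsub>C\<^esub> MMap G (\<alpha> (OMap F A)))"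
  unfolding nat_iso_def
proof (intro conjI ballI)
  interpret category C by (fact C)
  have a: "iso_arr D (OMap P Y) Y (\<alpha> Y)" if "Y \<in> Obj D" for Y
    using that \<alpha> by (auto simp: nat_iso_def id_fctr_def)
  have b: "iso_arr C (OMap G (OMap F A)) A (\<beta> A)" if "A \<in> Obj C" for A
    using that \<beta> by (auto simp: nat_iso_def id_fctr_def comp_fctr_def)
  note Fo = functor_Obj[OF F] and Go = functor_Obj[OF G] and Po = functor_Obj[OF P]
  show "iso_arr C (OMap (comp_fctr G (comp_fctr P F)) A) (OMap id_fctr A)
      (\<beta> A \<cdot>\<^bsub>C\<^esub> MMap G (\<alpha> (OMap F A)))" if A: "A \<in> Obj C" for A
    using iso_arr_comp[OF functor_iso_arr[OF G a[OF Fo[OF A]]] b[OF A]]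
    by (simp add: comp_fctr_def id_fctr_def)
  show "(\<beta> B \<cdot>\<^bsub>C\<^esub> MMap G (\<alpha> (OMap F B))) \<cdot>\<^bsub>C\<^esub> MMap (comp_fctr G (comp_fctr P F)) f =
      MMap id_fctr f \<cdot>\<^bsub>C\<^esub> (\<beta> A \<cdot>\<^bsub>C\<^esub> MMap G (\<alpha> (OMap F A)))"
    if A: "A \<in> Obj C" and B: "B \<in> Obj C" and f: "f \<in> Hom C A B" for A B f
  proof -
    let ?FA = "OMap F A" and ?FB = "OMap F B" and ?Ff = "MMap F f"
    note O = Fo[OF A] Fo[OF B]
    note PO = Po[OF O(1)] Po[OF O(2)]
    have Ff: "?Ff \<in> Hom D ?FA ?FB"
      using functor_Hom[OF F A B f] .
    have PFf: "MMap P ?Ff \<in> Hom D (OMap P ?FA) (OMap P ?FB)"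
      using functor_Hom[OF P O Ff] .
    have aH: "\<alpha> ?FA \<in> Hom D (OMap P ?FA) ?FA" "\<alpha> ?FB \<in> Hom D (OMap P ?FB) ?FB"
      using a O by (auto simp: iso_arr_def)
    have bH: "\<beta> A \<in> Hom C (OMap G ?FA) A" "\<beta> B \<in> Hom C (OMap G ?FB) B"
      using b A B by (auto simp: iso_arr_def)
    have na: "\<alpha> ?FB \<cdot>\<^bsub>D\<^esub> MMap P ?Ff = ?Ff \<cdot>\<^bsub>D\<^esub> \<alpha> ?FA"
      using \<alpha> O Ff by (auto simp: nat_iso_def id_fctr_def)
    have nb: "\<beta> B \<cdot>\<^bsub>C\<^esub> MMap G ?Ff = f \<cdot>\<^bsub>C\<^esub> \<beta> A"
      using \<beta> A B f by (auto simp: nat_iso_def id_fctr_def comp_fctr_def)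
    note GO = Go[OF O(1)] Go[OF O(2)] and GPO = Go[OF PO(1)] Go[OF PO(2)]
    note GH = functor_Hom[OF G PO PFf] functor_Hom[OF G PO(1) O(1) aH(1)]
      functor_Hom[OF G PO(2) O(2) aH(2)] functor_Hom[OF G O Ff]
    have "(\<beta> B \<cdot>\<^bsub>C\<^esub> MMap G (\<alpha> ?FB)) \<cdot>\<^bsub>C\<^esub> MMap G (MMap P ?Ff) =
        \<beta> B \<cdot>\<^bsub>C\<^esub> (MMap G (\<alpha> ?FB) \<cdot>\<^bsub>C\<^esub> MMap G (MMap P ?Ff))"
      using Comp_assoc[OF GPO GO(2) B GH(1,3) bH(2)] .
    also have "\<dots> = \<beta> B \<cdot>\<^bsub>C\<^esub> (MMap G ?Ff \<cdot>\<^bsub>C\<^esub> MMap G (\<alpha> ?FA))"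
      using functor_Comp[OF G PO O(2) PFf aH(2)] functor_Comp[OF G PO(1) O aH(1) Ff] na by simp
    also have "\<dots> = (f \<cdot>\<^bsub>C\<^esub> \<beta> A) \<cdot>\<^bsub>C\<^esub> MMap G (\<alpha> ?FA)"
      using Comp_assoc[OF GPO(1) GO B GH(2,4) bH(2)] nb by simp
    also have "\<dots> = f \<cdot>\<^bsub>C\<^esub> (\<beta> A \<cdot>\<^bsub>C\<^esub> MMap G (\<alpha> ?FA))"
      using Comp_assoc[OF GPO(1) GO(1) A B GH(2) bH(1) f] .
    finally show ?thesis
      by (simp add: comp_fctr_def id_fctr_def)
  qed
qed

lemma equivalence_comp:
  assumes C: "category C" and E: "category E"
    and F: "equivalence C D F" and F': "equivalence D E F'"
  shows "equivalence C E (comp_fctr F' F)"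
proof -
  obtain G \<eta> \<epsilon> where G: "is_functor C D F" "is_functor D C G"
      "nat_iso C C (comp_fctr G F) id_fctr \<eta>" "nat_iso D D (comp_fctr F G) id_fctr \<epsilon>"
    using F by (auto simp: equivalence_def)
  obtain G' \<eta>' \<epsilon>' where G': "is_functor D E F'" "is_functor E D G'"
      "nat_iso D D (comp_fctr G' F') id_fctr \<eta>'" "nat_iso E E (comp_fctr F' G') id_fctr \<epsilon>'"
    using F' by (auto simp: equivalence_def)
  have "comp_fctr (comp_fctr G G') (comp_fctr F' F) = comp_fctr G (comp_fctr (comp_fctr G' F') F)"
    "comp_fctr (comp_fctr F' F) (comp_fctr G G') = comp_fctr F' (comp_fctr (comp_fctr F G) G')"
    by (simp_all add: comp_fctr_def)
  then have "\<exists>\<eta>. nat_iso C C (comp_fctr (comp_fctr G G') (comp_fctr F' F)) id_fctr \<eta>"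
    "\<exists>\<epsilon>. nat_iso E E (comp_fctr (comp_fctr F' F) (comp_fctr G G')) id_fctr \<epsilon>"
    using nat_iso_sandwich[OF C G(1,2) is_functor_comp[OF G'(1,2)] G'(3) G(3)]
      nat_iso_sandwich[OF E G'(2,1) is_functor_comp[OF G(2,1)] G(4) G'(4)] by auto
  then show ?thesis
    unfolding equivalence_def using is_functor_comp[OF G(1) G'(1)] is_functor_comp[OF G'(2) G(2)]
    by blast
qed

section \<open>Linear bijections between Hom spaces\<close>

lemma linear_map_class_ringI:
  assumes "vectorspace (class_ring :: 'k::field ring) V" "vectorspace (class_ring :: 'k ring) W"
    and "\<And>x. x \<in> carrier V \<Longrightarrow> h x \<in> carrier W"
    and "\<And>x y. x \<in> carrier V \<Longrightarrow> y \<in> carrier V \<Longrightarrow> h (x \<oplus>\<^bsub>V\<^esub> y) = h x \<oplus>\<^bsub>W\<^esub> h y"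
    and "\<And>c x. x \<in> carrier V \<Longrightarrow> h (c \<odot>\<^bsub>V\<^esub> x) = c \<odot>\<^bsub>W\<^esub> h x"
  shows "linear_map (class_ring :: 'k ring) V W h"
proof -
  interpret V: vectorspace "class_ring :: 'k ring" V by (fact assms)
  interpret W: vectorspace "class_ring :: 'k ring" W by (fact assms)
  show ?thesis
    by unfold_locales (use assms in \<open>auto simp: module_hom_def\<close>)
qed

lemma linear_map_class_ringD:
  assumes "linear_map (class_ring :: 'k::field ring) V W h"
  shows "vectorspace (class_ring :: 'k ring) V" "vectorspace (class_ring :: 'k ring) W"
    and "\<And>x. x \<in> carrier V \<Longrightarrow> h x \<in> carrier W"
    and "\<And>x y. x \<in> carrier V \<Longrightarrow> y \<in> carrier V \<Longrightarrow> h (x \<oplus>\<^bsub>V\<^esub> y) = h x \<oplus>\<^bsub>W\<^esub> h y"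
    and "\<And>c x. x \<in> carrier V \<Longrightarrow> h (c \<odot>\<^bsub>V\<^esub> x) = c \<odot>\<^bsub>W\<^esub> h x"
    and "h \<zero>\<^bsub>V\<^esub> = \<zero>\<^bsub>W\<^esub>"
proof -
  interpret linear_map "class_ring :: 'k ring" V W h by (fact assms)
  show "vectorspace (class_ring :: 'k ring) V" "vectorspace (class_ring :: 'k ring) W"
    by unfold_locales
  show "\<And>x. x \<in> carrier V \<Longrightarrow> h x \<in> carrier W"
    and "\<And>x y. x \<in> carrier V \<Longrightarrow> y \<in> carrier V \<Longrightarrow> h (x \<oplus>\<^bsub>V\<^esub> y) = h x \<oplus>\<^bsub>W\<^esub> h y"
    and "\<And>c x. x \<in> carrier V \<Longrightarrow> h (c \<odot>\<^bsub>V\<^esub> x) = c \<odot>\<^bsub>W\<^esub> h x"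
    and "h \<zero>\<^bsub>V\<^esub> = \<zero>\<^bsub>W\<^esub>"
    using f_im f_add f_smult by auto
qed

lemma linear_map_comp:
  assumes "linear_map (class_ring :: 'k::field ring) U V h"
    and "linear_map (class_ring :: 'k ring) V W k"
  shows "linear_map (class_ring :: 'k ring) U W (\<lambda>x. k (h x))"
  using linear_map_class_ringD[OF assms(1)] linear_map_class_ringD[OF assms(2)]
  by (intro linear_map_class_ringI) simp_all

lemma linear_map_inv_into:
  assumes lin: "linear_map (class_ring :: 'k::field ring) V W h"
    and bij: "bij_betw h (carrier V) (carrier W)"
  shows "linear_map (class_ring :: 'k ring) W V (inv_into (carrier V) h)"
proof -
  note h = linear_map_class_ringD[OF lin]
  let ?g = "inv_into (carrier V) h"
  interpret V: vectorspace "class_ring :: 'k ring" V by (fact h)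
  have g: "?g y \<in> carrier V" "h (?g y) = y" if "y \<in> carrier W" for y
    using that bij by (auto simp: bij_betw_def inv_into_into f_inv_into_f)
  have gh: "?g (h x) = x" if "x \<in> carrier V" for x
    using that bij by (simp add: bij_betw_def)
  show ?thesis
  proof (rule linear_map_class_ringI[OF h(2,1)])
    show "?g y \<in> carrier V" if "y \<in> carrier W" for y
      using that by (rule g)
    show "?g (x \<oplus>\<^bsub>W\<^esub> y) = ?g x \<oplus>\<^bsub>V\<^esub> ?g y" if "x \<in> carrier W" "y \<in> carrier W" for x y
      using gh[of "?g x \<oplus>\<^bsub>V\<^esub> ?g y"] h(4)[of "?g x" "?g y"] that g by simp
    show "?g (c \<odot>\<^bsub>W\<^esub> y) = c \<odot>\<^bsub>V\<^esub> ?g y" if "y \<in> carrier W" for c y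
      using gh[of "c \<odot>\<^bsub>V\<^esub> ?g y"] h(5)[of "?g y" c] that g by simp
  qed
qed

text \<open>\<open>\<phi>\<close> is an isomorphism of vector spaces from \<open>Hom(A, B)\<close> in \<open>C\<close> to \<open>Hom(A', B')\<close> in
  \<open>D\<close>.  It need not come from a functor or from morphisms between the objects.\<close>

definition hom_iso ::
  "('o1, 'm1, 'k::field, 'z1) lincat_scheme \<Rightarrow> ('o2, 'm2, 'k, 'z2) lincat_scheme \<Rightarrow>
   'o1 \<Rightarrow> 'o1 \<Rightarrow> 'o2 \<Rightarrow> 'o2 \<Rightarrow> ('m1 \<Rightarrow> 'm2) \<Rightarrow> bool" where
  "hom_iso C D A B A' B' \<phi> \<longleftrightarrow>
     linear_map (class_ring :: 'k ring) (hom_space C A B) (hom_space D A' B') \<phi> \<and>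
     bij_betw \<phi> (Hom C A B) (Hom D A' B')"

lemma hom_iso_Zero: "hom_iso C D A B A' B' \<phi> \<Longrightarrow> \<phi> (Zero C A B) = Zero D A' B'"
  unfolding hom_iso_def using linear_map_class_ringD(6) by (fastforce simp: hom_space_def)

lemma hom_iso_Scale:
  "hom_iso C D A B A' B' \<phi> \<Longrightarrow> f \<in> Hom C A B \<Longrightarrow> \<phi> (Scale C c f) = Scale D c (\<phi> f)"
  unfolding hom_iso_def using linear_map_class_ringD(5) by (fastforce simp: hom_space_def)

lemma hom_iso_comp:
  "hom_iso C D A B A' B' \<phi> \<Longrightarrow> hom_iso D E A' B' A'' B'' \<psi> \<Longrightarrow>
    hom_iso C E A B A'' B'' (\<lambda>f. \<psi> (\<phi> f))"
  unfolding hom_iso_def using linear_map_comp bij_betw_trans[unfolded comp_def] by blast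

lemma hom_iso_vanish:
  fixes C :: "('o1, 'm1, 'k::field, 'z1) lincat_scheme"
    and D :: "('o2, 'm2, 'k, 'z2) lincat_scheme"
  assumes \<phi>: "hom_iso C D A B A' B' \<phi>"
  shows "Hom C A B = {Zero C A B} \<longleftrightarrow> Hom D A' B' = {Zero D A' B'}"
proof -
  have im: "\<phi> ` Hom C A B = Hom D A' B'" and inj: "inj_on \<phi> (Hom C A B)"
    using \<phi> by (auto simp: hom_iso_def bij_betw_def)
  have "vectorspace (class_ring :: 'k ring) (hom_space C A B)"
    using \<phi> linear_map_class_ringD(1) unfolding hom_iso_def by blast
  then interpret V: vectorspace "class_ring :: 'k ring" "hom_space C A B" .
  have "Zero C A B \<in> Hom C A B"
    using V.zero_closed by (simp add: hom_space_def)
  then show ?thesis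
    using im inj hom_iso_Zero[OF \<phi>] inj_on_image_eq_iff[OF inj, of "Hom C A B" "{Zero C A B}"]
    by auto
qed

lemma hom_iso_dim:
  fixes C :: "('o1, 'm1, 'k::field, 'z1) lincat_scheme"
    and D :: "('o2, 'm2, 'k, 'z2) lincat_scheme"
  assumes \<phi>: "hom_iso C D A B A' B' \<phi>"
  shows "hom_dim C A B = hom_dim D A' B'"
proof -
  let ?V = "hom_space C A B" and ?W = "hom_space D A' B'" and ?K = "class_ring :: 'k ring"
  have c: "carrier ?V = Hom C A B" "carrier ?W = Hom D A' B'"
    by (simp_all add: hom_space_def)
  have lin: "linear_map ?K ?V ?W \<phi>" and bij: "bij_betw \<phi> (carrier ?V) (carrier ?W)"
    using \<phi> by (simp_all add: hom_iso_def c)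
  have lin': "linear_map ?K ?W ?V (inv_into (carrier ?V) \<phi>)"
    and bij': "bij_betw (inv_into (carrier ?V) \<phi>) (carrier ?W) (carrier ?V)"
    using linear_map_inv_into[OF lin bij] bij_betw_inv_into[OF bij] .
  have "vectorspace.fin_dim ?K ?V \<longleftrightarrow> vectorspace.fin_dim ?K ?W"
    using linear_map.surj_fin_dim[OF lin] linear_map.surj_fin_dim[OF lin'] bij bij'
    by (auto simp: bij_betw_def)
  moreover have "vectorspace.dim ?K ?V = vectorspace.dim ?K ?W" if "vectorspace.fin_dim ?K ?V"
    using linear_map.dim_eq[OF lin that] bij by (auto simp: bij_betw_def)
  ultimately show ?thesis
    by (auto simp: hom_dim_def)
qed

context linear_category
begin

lemma
  assumes "A \<in> Obj C" "B \<in> Obj C"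
  shows Zero_in_Hom: "Zero C A B \<in> Hom C A B"
    and Plus_in_Hom: "f \<in> Hom C A B \<Longrightarrow> g \<in> Hom C A B \<Longrightarrow> Plus C f g \<in> Hom C A B"
    and Scale_in_Hom: "f \<in> Hom C A B \<Longrightarrow> Scale C c f \<in> Hom C A B"
    and Plus_assoc: "f \<in> Hom C A B \<Longrightarrow> g \<in> Hom C A B \<Longrightarrow> h \<in> Hom C A B \<Longrightarrow>
      Plus C (Plus C f g) h = Plus C f (Plus C g h)"
    and Plus_commute: "f \<in> Hom C A B \<Longrightarrow> g \<in> Hom C A B \<Longrightarrow> Plus C f g = Plus C g f"
    and Plus_Zero: "f \<in> Hom C A B \<Longrightarrow> Plus C f (Zero C A B) = f"
    and Plus_Scale_uminus: "f \<in> Hom C A B \<Longrightarrow> Plus C f (Scale C (- 1) f) = Zero C A B"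
    and Scale_0: "f \<in> Hom C A B \<Longrightarrow> Scale C 0 f = Zero C A B"
    and Scale_Zero: "Scale C c (Zero C A B) = Zero C A B"
proof -
  interpret V: vectorspace "class_ring :: 'k ring" "hom_space C A B"
    using hom_vectorspace[OF assms] .
  note s = hom_space_def
  show "Zero C A B \<in> Hom C A B" using V.zero_closed by (simp add: s)
  show "f \<in> Hom C A B \<Longrightarrow> g \<in> Hom C A B \<Longrightarrow> Plus C f g \<in> Hom C A B"
    using V.add.m_closed[of f g] by (simp add: s)
  show "f \<in> Hom C A B \<Longrightarrow> Scale C c f \<in> Hom C A B"
    using V.smult_closed[of c f] by (simp add: s)
  show "f \<in> Hom C A B \<Longrightarrow> g \<in> Hom C A B \<Longrightarrow> h \<in> Hom C A B \<Longrightarrow>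
      Plus C (Plus C f g) h = Plus C f (Plus C g h)"
    using V.add.m_assoc[of f g h] by (simp add: s)
  show "f \<in> Hom C A B \<Longrightarrow> g \<in> Hom C A B \<Longrightarrow> Plus C f g = Plus C g f"
    using V.add.m_comm[of f g] by (simp add: s)
  show "f \<in> Hom C A B \<Longrightarrow> Plus C f (Zero C A B) = f"
    using V.add.r_one[of f] by (simp add: s)
  show z: "f \<in> Hom C A B \<Longrightarrow> Scale C 0 f = Zero C A B" for f
    using V.smult_l_null[of f] by (simp add: s)
  have o: "f \<in> Hom C A B \<Longrightarrow> Scale C 1 f = f" for f
    using V.smult_one[of f] by (simp add: s)
  show "f \<in> Hom C A B \<Longrightarrow> Plus C f (Scale C (- 1) f) = Zero C A B"
    using V.smult_l_distr[of 1 "- 1" f] z[of f] o[of f] by (simp add: s)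
  show "Scale C c (Zero C A B) = Zero C A B"
    using V.smult_r_null[of c] by (simp add: s)
qed

lemma Comp_Zero_right:
  assumes "A \<in> Obj C" "B \<in> Obj C" "D \<in> Obj C" "g \<in> Hom C B D"
  shows "g \<cdot> Zero C A B = Zero C A D"
  using assms Comp_Scale_right[of A B D "Zero C A B" g 0] Zero_in_Hom[of A B]
    Scale_0[of A D "g \<cdot> Zero C A B"] Scale_0[of A B "Zero C A B"]
    Comp_in_Hom[of A B D "Zero C A B" g] by simp

lemma Comp_Zero_left:
  assumes "A \<in> Obj C" "B \<in> Obj C" "D \<in> Obj C" "f \<in> Hom C A B"
  shows "Zero C B D \<cdot> f = Zero C A D"
  using assms Comp_Scale_left[of A B D f "Zero C B D" 0] Zero_in_Hom[of B D]
    Scale_0[of A D "Zero C B D \<cdot> f"] Scale_0[of B D "Zero C B D"]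
    Comp_in_Hom[of A B D f "Zero C B D"] by simp

text \<open>Conjugation by isomorphisms \<open>f : A \<rightarrow> A'\<close> and \<open>g : B \<rightarrow> B'\<close>.\<close>

lemma hom_iso_conjugation:
  assumes f: "f \<in> Hom C A A'" "f' \<in> Hom C A' A" "f' \<cdot> f = Ident C A" "f \<cdot> f' = Ident C A'"
    and g: "g \<in> Hom C B B'" "g' \<in> Hom C B' B" "g' \<cdot> g = Ident C B" "g \<cdot> g' = Ident C B'"
    and O: "A \<in> Obj C" "A' \<in> Obj C" "B \<in> Obj C" "B' \<in> Obj C"
  shows "hom_iso C C A B A' B' (\<lambda>h. g \<cdot> (h \<cdot> f'))"
  unfolding hom_iso_def
proof
  have hf: "h \<cdot> f' \<in> Hom C A' B" if "h \<in> Hom C A B" for h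
    using Comp_in_Hom[OF O(2,1,3) f(2) that] .
  have c: "g \<cdot> (h \<cdot> f') \<in> Hom C A' B'" if "h \<in> Hom C A B" for h
    using Comp_in_Hom[OF O(2,3,4) hf[OF that] g(1)] .
  have gh: "g' \<cdot> h \<in> Hom C A' B" if "h \<in> Hom C A' B'" for h
    using Comp_in_Hom[OF O(2,4,3) that g(2)] .
  have c': "g' \<cdot> h \<cdot> f \<in> Hom C A B" if h: "h \<in> Hom C A' B'" for h
    using Comp_in_Hom[OF O(1,2,3) f(1) gh[OF h]] Comp_assoc[OF O(1,2,4,3) f(1) h g(2)] by simp
  show "linear_map (class_ring :: 'k ring) (hom_space C A B) (hom_space C A' B') (\<lambda>h. g \<cdot> (h \<cdot> f'))"
    by (rule linear_map_class_ringI[OF hom_vectorspace hom_vectorspace])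
      (use O f g c hf in \<open>simp_all add: hom_space_def Comp_Plus_left[OF O(2,1,3) f(2)]
        Comp_Plus_right[OF O(2,3,4) hf hf g(1)] Comp_Scale_left[OF O(2,1,3) f(2)]
        Comp_Scale_right[OF O(2,3,4) hf g(1)]\<close>)
  show "bij_betw (\<lambda>h. g \<cdot> (h \<cdot> f')) (Hom C A B) (Hom C A' B')"
  proof (rule bij_betwI[where g = "\<lambda>h. g' \<cdot> (h \<cdot> f)"])
    show "(\<lambda>h. g \<cdot> (h \<cdot> f')) \<in> Hom C A B \<rightarrow> Hom C A' B'"
      using c by blast
    show "(\<lambda>h. g' \<cdot> (h \<cdot> f)) \<in> Hom C A' B' \<rightarrow> Hom C A B"
      using c' by blast
    show "g' \<cdot> ((g \<cdot> (h \<cdot> f')) \<cdot> f) = h" if h: "h \<in> Hom C A B" for h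
    proof -
      have "(g \<cdot> (h \<cdot> f')) \<cdot> f = g \<cdot> ((h \<cdot> f') \<cdot> f)"
        using Comp_assoc[OF O(1,2,3,4) f(1) hf[OF h] g(1)] .
      then show ?thesis
        using cancel_right[OF O(1,2,3) f(1,2) h f(3)] cancel_left[OF O(1,3,4) h g(1,2,3)] by simp
    qed
    show "g \<cdot> ((g' \<cdot> (h \<cdot> f)) \<cdot> f') = h" if h: "h \<in> Hom C A' B'" for h
    proof -
      have hf: "h \<cdot> f \<in> Hom C A B'"
        using Comp_in_Hom[OF O(1,2,4) f(1) h] .
      have "(g' \<cdot> (h \<cdot> f)) \<cdot> f' = g' \<cdot> ((h \<cdot> f) \<cdot> f')"
        using Comp_assoc[OF O(2,1,4,3) f(2) hf g(2)] .
      then show ?thesis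
        using cancel_right[OF O(2,1,4) f(2,1) h f(4)] cancel_left[OF O(2,4,3) h g(2,1,4)] by simp
    qed
  qed
qed

text \<open>If \<open>n\<^sup>2 = 0\<close> then \<open>1 - n\<close> is inverse to \<open>1 + n\<close>.\<close>

lemma iso_arr_Ident_plus_square_zero:
  assumes Z: "Z \<in> Obj C" and n: "n \<in> Hom C Z Z" and nn: "n \<cdot> n = Zero C Z Z"
  shows "iso_arr C Z Z (Plus C (Ident C Z) n)"
proof -
  let ?e = "Ident C Z" and ?m = "Scale C (- 1) n"
  note I = Ident_in_Hom[OF Z] and PH = Plus_in_Hom[OF Z Z] and m = Scale_in_Hom[OF Z Z n]
  have mn: "?m \<cdot> n = Zero C Z Z" and nm: "n \<cdot> ?m = Zero C Z Z"
    using Comp_Scale_left[OF Z Z Z n n] Comp_Scale_right[OF Z Z Z n n] nn Scale_Zero[OF Z Z] by auto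
  have prod: "Plus C ?e x \<cdot> Plus C ?e y = ?e"
    if x: "x \<in> Hom C Z Z" and y: "y \<in> Hom C Z Z" and xy: "x \<cdot> y = Zero C Z Z"
      and s: "Plus C y x = Zero C Z Z" for x y
  proof -
    have "Plus C ?e x \<cdot> Plus C ?e y = Plus C (Plus C ?e y) (x \<cdot> Plus C ?e y)"
      using Comp_Plus_left[OF Z Z Z PH[OF I y] I x] Ident_left[OF Z Z PH[OF I y]] by simp
    also have "x \<cdot> Plus C ?e y = x"
      using Comp_Plus_right[OF Z Z Z I y x] Ident_right[OF Z Z x] xy Plus_Zero[OF Z Z x] by simp
    also have "Plus C (Plus C ?e y) x = ?e"
      using Plus_assoc[OF Z Z I y x] s Plus_Zero[OF Z Z I] by simp
    finally show ?thesis .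
  qed
  have s: "Plus C n ?m = Zero C Z Z" "Plus C ?m n = Zero C Z Z"
    using Plus_Scale_uminus[OF Z Z n] Plus_commute[OF Z Z n m] by simp_all
  show ?thesis
    unfolding iso_arr_def using Z PH[OF I n] PH[OF I m] prod[OF n m nm s(2)] prod[OF m n mn s(1)]
    by blast
qed

end

section \<open>Triangulated categories and their triangulated subcategories\<close>

lemma funpow_closed:
  "(\<And>X. X \<in> S \<Longrightarrow> f X \<in> S) \<Longrightarrow> X \<in> S \<Longrightarrow> (f ^^ n) X \<in> S"
  by (induction n) auto

context triangulated_category
begin

lemma Shift_functor: "is_functor C C (Shift C)"
  using Shift_linear by (simp add: linear_functor_def)

lemma shift_Obj: "X \<in> Obj C \<Longrightarrow> shO C X \<in> Obj C"
  using Shift_bij_Obj by (auto simp: bij_betw_def)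

lemma unshift_Obj: "X \<in> Obj C \<Longrightarrow> unshO C X \<in> Obj C"
  unfolding unshO_def using Shift_bij_Obj by (metis bij_betw_def inv_into_into)

lemma shift_unshift: "X \<in> Obj C \<Longrightarrow> shO C (unshO C X) = X"
  unfolding unshO_def using Shift_bij_Obj by (metis bij_betw_def f_inv_into_f)

lemma unshift_shift: "X \<in> Obj C \<Longrightarrow> unshO C (shO C X) = X"
  unfolding unshO_def using Shift_bij_Obj by (simp add: bij_betw_def)

lemma shift_Hom:
  "X \<in> Obj C \<Longrightarrow> Y \<in> Obj C \<Longrightarrow> f \<in> Hom C X Y \<Longrightarrow> shM C f \<in> Hom C (shO C X) (shO C Y)"
  by (rule functor_Hom[OF Shift_functor])

lemma shift_hom_iso:
  assumes "X \<in> Obj C" "Y \<in> Obj C"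
  shows "hom_iso C C X Y (shO C X) (shO C Y) (shM C)"
  using assms Shift_linear Shift_fully_faithful
  by (auto simp: hom_iso_def linear_functor_def fully_faithful_def)

lemma shift_reflects_isomorphic:
  "X \<in> Obj C \<Longrightarrow> Y \<in> Obj C \<Longrightarrow> isomorphic C (shO C X) (shO C Y) \<Longrightarrow> isomorphic C X Y"
  by (rule fully_faithful_reflects_isomorphic[OF category_axioms Shift_functor Shift_fully_faithful])

lemma shift_by_Obj: "X \<in> Obj C \<Longrightarrow> shift_by C i X \<in> Obj C"
  unfolding shift_by_def
  using funpow_closed[of "Obj C" "shO C"] funpow_closed[of "Obj C" "unshO C"]
    shift_Obj unshift_Obj by simp

lemma dist_triD:
  assumes "dist_tri C X Y Z u v w"
  shows "X \<in> Obj C" "Y \<in> Obj C" "Z \<in> Obj C"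
    "u \<in> Hom C X Y" "v \<in> Hom C Y Z" "w \<in> Hom C Z (shO C X)"
  using assms by (auto simp: dist_tri_def triangle_def)

lemma dist_tri_rotate:
  "dist_tri C X Y Z u v w \<Longrightarrow> dist_tri C Y Z (shO C X) v w (Scale C (- 1) (shM C u))"
  using TR2[of X Y Z u v w] by (simp add: dist_tri_def)

text \<open>Exactness of \<open>Hom(-, W)\<close> on a distinguished triangle.\<close>

lemma dist_tri_factor:
  assumes d: "dist_tri C X Y Z u v w" and W: "W \<in> Obj C" and g: "g \<in> Hom C Y W"
    and gu: "g \<cdot> u = Zero C X W"
  obtains t where "t \<in> Hom C Z W" "t \<cdot> v = g"
proof -
  note D = dist_triD[OF d]
  obtain N where N: "zero_object C N"
    using has_zero_object by blast
  then have NO: "N \<in> Obj C"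
    by (simp add: zero_object_def)
  let ?M = "unshO C N"
  have M: "?M \<in> Obj C" "shO C ?M = N"
    using unshift_Obj shift_unshift NO by auto
  have shZ: "Scale C (- 1) (shM C (Zero C ?M W)) = Zero C N (shO C W)"
    using hom_iso_Zero[OF shift_hom_iso[OF M(1) W]] M Scale_Zero[OF NO shift_Obj[OF W]] by simp
  \<comment> \<open>The triangle whose rotation is the one on the identity of \<open>W\<close>.\<close>
  have tri: "dist_tri C ?M W W (Zero C ?M W) (Ident C W) (Zero C W N)"
    using TR2[of ?M W W "Zero C ?M W" "Ident C W" "Zero C W N"] TR1_Ident[OF W N] shZ M NO W
      Zero_in_Hom Ident_in_Hom by (simp add: triangle_def)
  have "g \<cdot> u = Zero C ?M W \<cdot> Zero C X ?M"
    using gu Comp_Zero_left[OF D(1) M(1) W] Zero_in_Hom[OF D(1) M(1)] by simp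
  then obtain t where "t \<in> Hom C Z W" "t \<cdot> v = Ident C W \<cdot> g"
    using TR3[OF d tri Zero_in_Hom[OF D(1) M(1)] g] by blast
  then show ?thesis
    using that Ident_left[OF D(2) W g] by simp
qed

text \<open>If \<open>e\<close> is an endomorphism of the third vertex that is compatible with the identities of
  the other two, then \<open>e - 1\<close> factors through \<open>w\<close> and is killed by \<open>w\<close>, so that
  \<open>(e - 1)\<^sup>2 = 0\<close>.\<close>

lemma cone_endomorphism_iso:
  assumes d: "dist_tri C X Y Z u v w" and e: "e \<in> Hom C Z Z"
    and ev: "e \<cdot> v = v" and we: "w \<cdot> e = w"
  shows "iso_arr C Z Z e"
proof -
  note D = dist_triD[OF d]
  note sX = shift_Obj[OF D(1)] and Z = D(3) and Y = D(2)
  let ?i = "Ident C Z"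
  note I = Ident_in_Hom[OF Z]
  have mi: "Scale C (- 1) ?i \<in> Hom C Z Z"
    using Scale_in_Hom[OF Z Z I] .
  define n where "n = Plus C e (Scale C (- 1) ?i)"
  have n: "n \<in> Hom C Z Z"
    unfolding n_def using Plus_in_Hom[OF Z Z e mi] .
  have "n \<cdot> v = Plus C v (Scale C (- 1) v)"
    unfolding n_def using Comp_Plus_left[OF Y Z Z D(5) e mi] ev Comp_Scale_left[OF Y Z Z D(5) I]
      Ident_left[OF Y Z D(5)] by simp
  then have nv: "n \<cdot> v = Zero C Y Z"
    using Plus_Scale_uminus[OF Y Z D(5)] by simp
  have "w \<cdot> n = Plus C w (Scale C (- 1) w)"
    unfolding n_def using Comp_Plus_right[OF Z Z sX e mi D(6)] we Comp_Scale_right[OF Z Z sX I D(6)]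
      Ident_right[OF Z sX D(6)] by simp
  then have wn: "w \<cdot> n = Zero C Z (shO C X)"
    using Plus_Scale_uminus[OF Z sX D(6)] by simp
  obtain t where t: "t \<in> Hom C (shO C X) Z" "t \<cdot> w = n"
    using dist_tri_factor[OF dist_tri_rotate[OF d] Z n nv] .
  have "n \<cdot> n = Zero C Z Z"
    using Comp_assoc[OF Z Z sX Z n D(6) t(1)] t(2) wn Comp_Zero_right[OF Z sX Z t(1)] by simp
  then have "iso_arr C Z Z (Plus C ?i n)"
    using iso_arr_Ident_plus_square_zero[OF Z n] by simp
  moreover have "Plus C ?i n = e"
    using Plus_commute[OF Z Z I n] Plus_assoc[OF Z Z e mi I] Plus_commute[OF Z Z mi I]
      Plus_Scale_uminus[OF Z Z I] Plus_Zero[OF Z Z e] by (simp add: n_def)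
  ultimately show ?thesis
    by simp
qed

text \<open>Isomorphic morphisms have isomorphic cones.\<close>

lemma cone_unique:
  assumes d: "dist_tri C X Y Z u v w" and d': "dist_tri C X' Y' Z' u' v' w'"
    and f: "iso_arr C X X' f" and g: "iso_arr C Y Y' g" and gu: "g \<cdot> u = u' \<cdot> f"
  shows "isomorphic C Z Z'"
proof -
  \<comment> \<open>The maps \<open>h\<close> and \<open>h'\<close> between the cones need not be mutually inverse, but both composites
    are isomorphisms; by symmetry one composite suffices.\<close>
  have half: "iso_arr C Z Z (h' \<cdot> h)"
    if d: "dist_tri C X Y Z u v w" and d': "dist_tri C X' Y' Z' u' v' w'"
      and f: "f \<in> Hom C X X'" "f' \<in> Hom C X' X" "f' \<cdot> f = Ident C X"
      and g: "g \<in> Hom C Y Y'" "g' \<in> Hom C Y' Y" "g' \<cdot> g = Ident C Y"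
      and h: "h \<in> Hom C Z Z'" "h \<cdot> v = v' \<cdot> g" "shM C f \<cdot> w = w' \<cdot> h"
      and h': "h' \<in> Hom C Z' Z" "h' \<cdot> v' = v \<cdot> g'" "shM C f' \<cdot> w' = w \<cdot> h'"
    for X Y Z u v w X' Y' Z' u' v' w' f f' g g' h h'
  proof (rule cone_endomorphism_iso[OF d])
    note D = dist_triD[OF d] and D' = dist_triD[OF d']
    note sX = shift_Obj[OF D(1)] and sX' = shift_Obj[OF D'(1)]
    note sf = shift_Hom[OF D(1) D'(1) f(1)] and sf' = shift_Hom[OF D'(1) D(1) f(2)]
    show "h' \<cdot> h \<in> Hom C Z Z"
      using Comp_in_Hom[OF D(3) D'(3) D(3) h(1) h'(1)] .
    have "(h' \<cdot> h) \<cdot> v = (h' \<cdot> v') \<cdot> g"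
      using Comp_assoc[OF D(2,3) D'(3) D(3) D(5) h(1) h'(1)] h(2)
        Comp_assoc[OF D(2) D'(2,3) D(3) g(1) D'(5) h'(1)] by simp
    then show "(h' \<cdot> h) \<cdot> v = v"
      using h'(2) cancel_right[OF D(2) D'(2) D(3) g(1,2) D(5) g(3)] by simp
    have "w \<cdot> (h' \<cdot> h) = shM C f' \<cdot> (w' \<cdot> h)"
      using Comp_assoc[OF D(3) D'(3) D(3) sX h(1) h'(1) D(6)] h'(3)
        Comp_assoc[OF D(3) D'(3) sX' sX h(1) D'(6) sf'] by simp
    moreover have "shM C f' \<cdot> shM C f = Ident C (shO C X)"
      using functor_Comp[OF Shift_functor D(1) D'(1) D(1) f(1,2)] f(3)
        functor_Ident[OF Shift_functor D(1)] by simp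
    ultimately show "w \<cdot> (h' \<cdot> h) = w"
      using h(3) cancel_left[OF D(3) sX sX' D(6) sf sf'] by simp
  qed
  obtain f' where f': "iso_arr C X' X f'" "f' \<cdot> f = Ident C X" "f \<cdot> f' = Ident C X'"
    using f by (rule iso_arr_inverse)
  obtain g' where g': "iso_arr C Y' Y g'" "g' \<cdot> g = Ident C Y" "g \<cdot> g' = Ident C Y'"
    using g by (rule iso_arr_inverse)
  have H: "f \<in> Hom C X X'" "f' \<in> Hom C X' X" "g \<in> Hom C Y Y'" "g' \<in> Hom C Y' Y"
    using f f' g g' by (auto simp: iso_arr_def)
  note D = dist_triD[OF d] and D' = dist_triD[OF d']
  have u: "u' \<cdot> f \<in> Hom C X Y'"
    using Comp_in_Hom[OF D(1) D'(1,2) H(1) D'(4)] .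
  have "g' \<cdot> u' = g' \<cdot> ((u' \<cdot> f) \<cdot> f')"
    using cancel_right[OF D'(1) D(1) D'(2) H(2,1) D'(4) f'(3)] by simp
  also have "\<dots> = (g' \<cdot> (g \<cdot> u)) \<cdot> f'"
    using Comp_assoc[OF D'(1) D(1) D'(2) D(2) H(2) u H(4)] gu by simp
  also have "g' \<cdot> (g \<cdot> u) = u"
    using cancel_left[OF D(1,2) D'(2) D(4) H(3,4) g'(2)] .
  finally have gu': "g' \<cdot> u' = u \<cdot> f'" .
  obtain h where h: "h \<in> Hom C Z Z'" "h \<cdot> v = v' \<cdot> g" "shM C f \<cdot> w = w' \<cdot> h"
    using TR3[OF d d' H(1,3) gu] by blast
  obtain h' where h': "h' \<in> Hom C Z' Z" "h' \<cdot> v' = v \<cdot> g'" "shM C f' \<cdot> w' = w \<cdot> h'"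
    using TR3[OF d' d H(2,4) gu'] by blast
  have "iso_arr C Z Z (h' \<cdot> h)"
    using half[OF d d' H(1,2) f'(2) H(3,4) g'(2) h h'] .
  then obtain p where p: "p \<in> Hom C Z Z" "p \<cdot> (h' \<cdot> h) = Ident C Z"
    by (auto simp: iso_arr_def)
  have "iso_arr C Z' Z' (h \<cdot> h')"
    using half[OF d' d H(2,1) f'(3) H(4,3) g'(3) h' h] .
  then obtain q where q: "q \<in> Hom C Z' Z'" "(h \<cdot> h') \<cdot> q = Ident C Z'"
    by (auto simp: iso_arr_def)
  have "(p \<cdot> h') \<cdot> h = Ident C Z"
    using Comp_assoc[OF D(3) D'(3) D(3,3) h(1) h'(1) p(1)] p(2) by simp
  moreover have "h \<cdot> (h' \<cdot> q) = Ident C Z'"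
    using Comp_assoc[OF D'(3,3) D(3) D'(3) q(1) h'(1) h(1)] q(2) by simp
  ultimately have "iso_arr C Z Z' h"
    using iso_arr_left_right_inverse[OF D(3) D'(3) h(1)
        Comp_in_Hom[OF D'(3) D(3,3) h'(1) p(1)] Comp_in_Hom[OF D'(3,3) D(3) q(1) h'(1)]] by blast
  then show ?thesis
    by (auto simp: isomorphic_def)
qed

lemma dist_tri_zero_if_iso_arr:
  assumes f: "iso_arr C X Y f" and N: "zero_object C N"
  shows "dist_tri C X Y N f (Zero C Y N) (Zero C N (shO C X))"
proof (rule TR1_iso)
  obtain g where g: "iso_arr C Y X g" "g \<cdot> f = Ident C X" "f \<cdot> g = Ident C Y"
    using f by (rule iso_arr_inverse)
  have O: "X \<in> Obj C" "Y \<in> Obj C" "N \<in> Obj C" and H: "f \<in> Hom C X Y"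
    using f N by (auto simp: iso_arr_def zero_object_def)
  note sX = shift_Obj[OF O(1)]
  have "Ident C N \<cdot> Zero C X N = Zero C Y N \<cdot> f"
    using Ident_left[OF O(1,3) Zero_in_Hom[OF O(1,3)]] Comp_Zero_left[OF O H] by simp
  moreover have "shM C (Ident C X) \<cdot> Zero C N (shO C X) = Zero C N (shO C X) \<cdot> Ident C N"
    using functor_Ident[OF Shift_functor O(1)] Zero_in_Hom[OF O(3) sX]
      Ident_left[OF O(3) sX] Ident_right[OF O(3) sX] by simp
  ultimately show "tri_isomorphic C X X N (Ident C X) (Zero C X N) (Zero C N (shO C X))
      X Y N f (Zero C Y N) (Zero C N (shO C X))"
    unfolding tri_isomorphic_def triangle_def
    using O H sX Zero_in_Hom Ident_in_Hom
    by (intro conjI exI[of _ "Ident C X"] exI[of _ f] exI[of _ "Ident C N"])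
      (simp_all add: iso_arr_Ident f Ident_right[OF O(1,2) H])
  show "dist_tri C X X N (Ident C X) (Zero C X N) (Zero C N (shO C X))"
    using TR1_Ident[OF O(1) N] .
qed

lemma
  assumes "triangulated_subcategory C B"
  shows triangulated_subcategory_subset: "B \<subseteq> Obj C"
    and triangulated_subcategory_shift: "X \<in> B \<Longrightarrow> shO C X \<in> B"
    and triangulated_subcategory_unshift: "X \<in> B \<Longrightarrow> unshO C X \<in> B"
    and triangulated_subcategory_extension:
      "dist_tri C X Y Z u v w \<Longrightarrow> X \<in> B \<Longrightarrow> Z \<in> B \<Longrightarrow> Y \<in> B"
proof -
  note B = assms[unfolded triangulated_subcategory_def]
  show "B \<subseteq> Obj C"
    using B by (elim conjE)
  have "\<forall>X \<in> B. shO C X \<in> B"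
    using B by (elim conjE)
  then show "X \<in> B \<Longrightarrow> shO C X \<in> B"
    by blast
  have "\<forall>X \<in> B. unshO C X \<in> B"
    using B by (elim conjE)
  then show "X \<in> B \<Longrightarrow> unshO C X \<in> B"
    by blast
  have "\<forall>X Y Z u v w. dist_tri C X Y Z u v w \<and> X \<in> B \<and> Z \<in> B \<longrightarrow> Y \<in> B"
    using B by (elim conjE)
  then show "dist_tri C X Y Z u v w \<Longrightarrow> X \<in> B \<Longrightarrow> Z \<in> B \<Longrightarrow> Y \<in> B"
    by blast
qed

lemma triangulated_subcategory_cone:
  assumes "triangulated_subcategory C B" "dist_tri C X Y Z u v w" "X \<in> B" "Y \<in> B"
  shows "Z \<in> B"
  using triangulated_subcategory_extension[OF assms(1) dist_tri_rotate[OF assms(2)] assms(4)]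
    triangulated_subcategory_shift[OF assms(1,3)] .

text \<open>Closure under cones may replace closure under extensions: rotating a triangle twice makes
  \<open>Y[1]\<close> the cone of \<open>Z \<rightarrow> X[1]\<close>.\<close>

lemma triangulated_subcategoryI_cone:
  assumes "B \<noteq> {}" and B: "B \<subseteq> Obj C"
    and sh: "\<And>X. X \<in> B \<Longrightarrow> shO C X \<in> B" and unsh: "\<And>X. X \<in> B \<Longrightarrow> unshO C X \<in> B"
    and cone: "\<And>X Y Z u v w. dist_tri C X Y Z u v w \<Longrightarrow> X \<in> B \<Longrightarrow> Y \<in> B \<Longrightarrow> Z \<in> B"
  shows "triangulated_subcategory C B"
proof -
  have "Y \<in> B" if d: "dist_tri C X Y Z u v w" and X: "X \<in> B" and Z: "Z \<in> B" for X Y Z u v w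
  proof -
    have "shO C Y \<in> B"
      using cone[OF dist_tri_rotate[OF dist_tri_rotate[OF d]] Z sh[OF X]] .
    then show ?thesis
      using unsh unshift_shift[OF dist_triD(2)[OF d]] by metis
  qed
  then show ?thesis
    unfolding triangulated_subcategory_def using assms(1) B sh unsh
    by (intro conjI allI impI ballI; (elim conjE)?) assumption+
qed

text \<open>An isomorphism \<open>X \<rightarrow> Y\<close> has cone zero, so \<open>Y\<close> is an extension of zero by \<open>X\<close>; and zero is
  the cone of the identity of \<open>X\<close>.\<close>

lemma triangulated_subcategory_isomorphic:
  assumes B: "triangulated_subcategory C B" and X: "X \<in> B" and XY: "isomorphic C X Y"
  shows "Y \<in> B"
proof -
  obtain f where f: "iso_arr C X Y f"
    using XY by (auto simp: isomorphic_def)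
  obtain N where N: "zero_object C N"
    using has_zero_object by blast
  have XO: "X \<in> Obj C"
    using isomorphic_Obj XY by blast
  have "N \<in> B"
    using triangulated_subcategory_cone[OF B TR1_Ident[OF XO N] X X] .
  then show ?thesis
    using triangulated_subcategory_extension[OF B dist_tri_zero_if_iso_arr[OF f N] X] by blast
qed

lemma triangulated_subcategory_Obj: "E \<in> Obj C \<Longrightarrow> triangulated_subcategory C (Obj C)"
  by (rule triangulated_subcategoryI_cone) (auto simp: shift_Obj unshift_Obj dest: dist_triD(3))

lemma generated_least: "triangulated_subcategory C B \<Longrightarrow> E \<in> B \<Longrightarrow> generated C E \<subseteq> B"
  unfolding generated_def by blast

lemma generated_self: "E \<in> generated C E"
  unfolding generated_def by blast

lemma triangulated_subcategory_generated:
  assumes E: "E \<in> Obj C"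
  shows "triangulated_subcategory C (generated C E)"
proof -
  have "generated C E \<subseteq> Obj C"
    using generated_least[OF triangulated_subcategory_Obj[OF E] E] .
  moreover have "generated C E \<noteq> {}"
    using generated_self by blast
  moreover have "shO C X \<in> generated C E" "unshO C X \<in> generated C E"
    if "X \<in> generated C E" for X
    using that triangulated_subcategory_shift triangulated_subcategory_unshift
    by (auto simp: generated_def)
  moreover have "Z \<in> generated C E"
    if "dist_tri C X Y Z u v w" "X \<in> generated C E" "Y \<in> generated C E" for X Y Z u v w
    using that triangulated_subcategory_cone[OF _ that(1)] by (auto simp: generated_def)
  ultimately show ?thesis
    by (intro triangulated_subcategoryI_cone)
qed

end

section \<open>Full subcategories\<close>

lemma full_subcat_sel [simp]:
  "Obj (full_subcat T B) = B" "Hom (full_subcat T B) = Hom T" "Ident (full_subcat T B) = Ident T"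
  "Comp (full_subcat T B) = Comp T"
  by (simp_all add: full_subcat_def)

lemma full_subcat_lin_sel [simp]:
  "hom_space (full_subcat T B) = hom_space T"
  by (intro ext) (simp add: full_subcat_def hom_space_def)

lemma full_subcat_tri_sel [simp]:
  "Shift (full_subcat T B) = Shift T" "Triangles (full_subcat T B) = Triangles T"
  by (simp_all add: full_subcat_def)

lemma dist_tri_full_subcat:
  "B \<subseteq> Obj T \<Longrightarrow> dist_tri (full_subcat T B) X Y Z u v w \<longleftrightarrow>
    X \<in> B \<and> Y \<in> B \<and> Z \<in> B \<and> dist_tri T X Y Z u v w"
  by (auto simp: dist_tri_def triangle_def)

lemma iso_arr_full_subcat:
  "B \<subseteq> Obj T \<Longrightarrow> iso_arr (full_subcat T B) X Y f \<longleftrightarrow> X \<in> B \<and> Y \<in> B \<and> iso_arr T X Y f"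
  by (auto simp: iso_arr_def)

lemma category_full_subcat:
  assumes "category T" "B \<subseteq> Obj T"
  shows "category (full_subcat T B)"
proof -
  interpret category T by (fact assms)
  note B = subsetD[OF assms(2)]
  show ?thesis
  proof (unfold_locales, unfold full_subcat_sel)
    show "A = A' \<and> D = D'" if "A \<in> B" "D \<in> B" "A' \<in> B" "D' \<in> B" "f \<in> Hom T A D" "f \<in> Hom T A' D'"
      for A D A' D' f
      using Hom_disjoint[OF B B B B] that by blast
    show "Ident T A \<in> Hom T A A" if "A \<in> B" for A
      using Ident_in_Hom[OF B] that by blast
    show "g \<cdot>\<^bsub>T\<^esub> f \<in> Hom T A E"
      if "A \<in> B" "D \<in> B" "E \<in> B" "f \<in> Hom T A D" "g \<in> Hom T D E" for A D E f g
      using Comp_in_Hom[OF B B B] that by blast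
    show "Ident T D \<cdot>\<^bsub>T\<^esub> f = f" "f \<cdot>\<^bsub>T\<^esub> Ident T A = f"
      if "A \<in> B" "D \<in> B" "f \<in> Hom T A D" for A D f
      using Ident_left[OF B B] Ident_right[OF B B] that by blast+
    show "(h \<cdot>\<^bsub>T\<^esub> g) \<cdot>\<^bsub>T\<^esub> f = h \<cdot>\<^bsub>T\<^esub> (g \<cdot>\<^bsub>T\<^esub> f)"
      if "A \<in> B" "D \<in> B" "E \<in> B" "G \<in> B" "f \<in> Hom T A D" "g \<in> Hom T D E" "h \<in> Hom T E G"
      for A D E G f g h
      using Comp_assoc[OF B B B B] that by blast
  qed
qed

lemma (in triangulated_category) is_functor_Shift_full_subcat:
  assumes B: "triangulated_subcategory C B"
  shows "is_functor (full_subcat C B) (full_subcat C B) (Shift (full_subcat C B))"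
proof -
  note BO = subsetD[OF triangulated_subcategory_subset[OF B]]
  show ?thesis
    unfolding is_functor_def full_subcat_sel full_subcat_tri_sel
    using triangulated_subcategory_shift[OF B] shift_Hom[OF BO BO]
      functor_Ident[OF Shift_functor BO] functor_Comp[OF Shift_functor BO BO BO] by blast
qed

text \<open>The shift isomorphism of the composite is \<open>F \<Phi> [1] \<rightarrow> F [1] \<Phi> \<rightarrow> [1] F \<Phi>\<close>.\<close>

lemma exact_functor_comp:
  assumes E: "category E" and f: "exact_functor A D \<Phi>" and F: "exact_functor D E F"
    and sh: "is_functor A A (Shift A)" "is_functor D D (Shift D)" "is_functor E E (Shift E)"
  shows "exact_functor A E (comp_fctr F \<Phi>)"
proof -
  interpret category E by (fact E)
  have \<Phi>f: "is_functor A D \<Phi>" and Ff: "is_functor D E F"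
    using f F by (auto simp: exact_functor_def)
  note fO = functor_Obj[OF \<Phi>f] and FO = functor_Obj[OF Ff]
    and fH = functor_Hom[OF \<Phi>f] and FH = functor_Hom[OF Ff] and FC = functor_Comp[OF Ff]
    and AO = functor_Obj[OF sh(1)] and AH = functor_Hom[OF sh(1)]
    and DO = functor_Obj[OF sh(2)] and DH = functor_Hom[OF sh(2)]
    and EO = functor_Obj[OF sh(3)] and EH = functor_Hom[OF sh(3)]
  obtain \<alpha> where \<alpha>: "nat_iso A D (comp_fctr \<Phi> (Shift A)) (comp_fctr (Shift D) \<Phi>) \<alpha>"
      "\<And>X Y Z u v w. dist_tri A X Y Z u v w \<Longrightarrow> dist_tri D (OMap \<Phi> X) (OMap \<Phi> Y) (OMap \<Phi> Z)
        (MMap \<Phi> u) (MMap \<Phi> v) (\<alpha> X \<cdot>\<^bsub>D\<^esub> MMap \<Phi> w)"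
    using f by (auto simp: exact_functor_def)
  obtain \<beta> where \<beta>: "nat_iso D E (comp_fctr F (Shift D)) (comp_fctr (Shift E) F) \<beta>"
      "\<And>X Y Z u v w. dist_tri D X Y Z u v w \<Longrightarrow> dist_tri E (OMap F X) (OMap F Y) (OMap F Z)
        (MMap F u) (MMap F v) (\<beta> X \<cdot>\<^bsub>E\<^esub> MMap F w)"
    using F by (auto simp: exact_functor_def)
  have a: "iso_arr D (OMap \<Phi> (shO A X)) (shO D (OMap \<Phi> X)) (\<alpha> X)" if "X \<in> Obj A" for X
    using \<alpha>(1) that by (auto simp: nat_iso_def comp_fctr_def)
  have b: "iso_arr E (OMap F (shO D X)) (shO E (OMap F X)) (\<beta> X)" if "X \<in> Obj D" for X
    using \<beta>(1) that by (auto simp: nat_iso_def comp_fctr_def)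
  have aH: "\<alpha> X \<in> Hom D (OMap \<Phi> (shO A X)) (shO D (OMap \<Phi> X))" if "X \<in> Obj A" for X
    using a[OF that] by (simp add: iso_arr_def)
  have bH: "\<beta> X \<in> Hom E (OMap F (shO D X)) (shO E (OMap F X))" if "X \<in> Obj D" for X
    using b[OF that] by (simp add: iso_arr_def)
  define \<gamma> where "\<gamma> X = \<beta> (OMap \<Phi> X) \<cdot>\<^bsub>E\<^esub> MMap F (\<alpha> X)" for X
  have \<gamma>: "\<gamma> X \<cdot>\<^bsub>E\<^esub> MMap F h = \<beta> (OMap \<Phi> X) \<cdot>\<^bsub>E\<^esub> MMap F (\<alpha> X \<cdot>\<^bsub>D\<^esub> h)"
    if X: "X \<in> Obj A" and W: "W \<in> Obj D" and h: "h \<in> Hom D W (OMap \<Phi> (shO A X))" for X W h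
    unfolding \<gamma>_def
    using Comp_assoc[OF FO[OF W] FO[OF fO[OF AO[OF X]]] FO[OF DO[OF fO[OF X]]] EO[OF FO[OF fO[OF X]]]
        FH[OF W fO[OF AO[OF X]] h] FH[OF fO[OF AO[OF X]] DO[OF fO[OF X]] aH[OF X]] bH[OF fO[OF X]]]
      FC[OF W fO[OF AO[OF X]] DO[OF fO[OF X]] h aH[OF X]] by simp
  have "nat_iso A E (comp_fctr (comp_fctr F \<Phi>) (Shift A)) (comp_fctr (Shift E) (comp_fctr F \<Phi>)) \<gamma>"
    unfolding nat_iso_def comp_fctr_def fctr.simps
  proof (intro conjI ballI)
    show "iso_arr E (OMap F (OMap \<Phi> (shO A X))) (shO E (OMap F (OMap \<Phi> X))) (\<gamma> X)"
      if X: "X \<in> Obj A" for X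
      unfolding \<gamma>_def using iso_arr_comp[OF functor_iso_arr[OF Ff a[OF X]] b[OF fO[OF X]]] .
    show "\<gamma> Y \<cdot>\<^bsub>E\<^esub> MMap F (MMap \<Phi> (shM A k)) = shM E (MMap F (MMap \<Phi> k)) \<cdot>\<^bsub>E\<^esub> \<gamma> X"
      if X: "X \<in> Obj A" and Y: "Y \<in> Obj A" and k: "k \<in> Hom A X Y" for X Y k
    proof -
      let ?X = "OMap \<Phi> X" and ?Y = "OMap \<Phi> Y" and ?k = "MMap \<Phi> k"
      note X' = fO[OF X] and Y' = fO[OF Y] and k' = fH[OF X Y k]
      note sX = fO[OF AO[OF X]] and sX' = DO[OF X'] and sY' = DO[OF Y']
      have "\<gamma> Y \<cdot>\<^bsub>E\<^esub> MMap F (MMap \<Phi> (shM A k)) = \<beta> ?Y \<cdot>\<^bsub>E\<^esub> MMap F (\<alpha> Y \<cdot>\<^bsub>D\<^esub> MMap \<Phi> (shM A k))"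
        using \<gamma>[OF Y sX fH[OF AO[OF X] AO[OF Y] AH[OF X Y k]]] .
      also have "\<alpha> Y \<cdot>\<^bsub>D\<^esub> MMap \<Phi> (shM A k) = shM D ?k \<cdot>\<^bsub>D\<^esub> \<alpha> X"
        using \<alpha>(1) X Y k by (auto simp: nat_iso_def comp_fctr_def)
      also have "\<beta> ?Y \<cdot>\<^bsub>E\<^esub> MMap F (shM D ?k \<cdot>\<^bsub>D\<^esub> \<alpha> X) = (\<beta> ?Y \<cdot>\<^bsub>E\<^esub> MMap F (shM D ?k)) \<cdot>\<^bsub>E\<^esub> MMap F (\<alpha> X)"
        using FC[OF sX sX' sY' aH[OF X] DH[OF X' Y' k']]
          Comp_assoc[OF FO[OF sX] FO[OF sX'] FO[OF sY'] EO[OF FO[OF Y']] FH[OF sX sX' aH[OF X]]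
            FH[OF sX' sY' DH[OF X' Y' k']] bH[OF Y']] by simp
      also have "\<beta> ?Y \<cdot>\<^bsub>E\<^esub> MMap F (shM D ?k) = shM E (MMap F ?k) \<cdot>\<^bsub>E\<^esub> \<beta> ?X"
        using \<beta>(1) X' Y' k' by (auto simp: nat_iso_def comp_fctr_def)
      also have "(shM E (MMap F ?k) \<cdot>\<^bsub>E\<^esub> \<beta> ?X) \<cdot>\<^bsub>E\<^esub> MMap F (\<alpha> X) = shM E (MMap F ?k) \<cdot>\<^bsub>E\<^esub> \<gamma> X"
        unfolding \<gamma>_def
        using Comp_assoc[OF FO[OF sX] FO[OF sX'] EO[OF FO[OF X']] EO[OF FO[OF Y']]
            FH[OF sX sX' aH[OF X]] bH[OF X'] EH[OF FO[OF X'] FO[OF Y'] FH[OF X' Y' k']]] .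
      finally show ?thesis .
    qed
  qed
  moreover have "dist_tri E (OMap F (OMap \<Phi> X)) (OMap F (OMap \<Phi> Y)) (OMap F (OMap \<Phi> Z))
      (MMap F (MMap \<Phi> u)) (MMap F (MMap \<Phi> v)) (\<gamma> X \<cdot>\<^bsub>E\<^esub> MMap F (MMap \<Phi> w))"
    if d: "dist_tri A X Y Z u v w" for X Y Z u v w
  proof -
    have X: "X \<in> Obj A" and Z: "Z \<in> Obj A" and w: "w \<in> Hom A Z (shO A X)"
      using d by (auto simp: dist_tri_def triangle_def)
    show ?thesis
      using \<beta>(2)[OF \<alpha>(2)[OF d]] \<gamma>[OF X fO[OF Z] fH[OF Z AO[OF X] w]] by simp
  qed
  ultimately show ?thesis
    unfolding exact_functor_def using is_functor_comp[OF \<Phi>f Ff]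
    by (auto intro!: exI[of _ \<gamma>] simp: comp_fctr_def)
qed

lemma linear_functor_comp:
  assumes "linear_functor A D \<Phi>" "linear_functor D E F"
  shows "linear_functor A E (comp_fctr F \<Phi>)"
proof -
  have f: "is_functor A D \<Phi>" "is_functor D E F"
    using assms by (auto simp: linear_functor_def)
  show ?thesis
    using is_functor_comp[OF f] assms functor_Obj[OF f(1)] linear_map_comp
    unfolding linear_functor_def comp_fctr_def by simp blast
qed

section \<open>Images of triangulated subcategories under a fully faithful exact functor\<close>

text \<open>Throughout, an object \<open>X'\<close> of \<open>T\<close> is compared with an object \<open>X\<close> of \<open>S\<close> by means of an
  isomorphism \<open>F X \<rightarrow> X'\<close>.  This is the relation that defines the image of a subcategory, and it is
  compatible with both shifts.\<close>

locale ff_exact_functor =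
  S: triangulated_category S + T: triangulated_category T
  for S :: "('o1, 'm1, 'k::field) tricat" and T :: "('o2, 'm2, 'k) tricat" +
  fixes F :: "('o1, 'm1, 'o2, 'm2) fctr"
  assumes F_linear: "linear_functor S T F"
    and F_exact: "exact_functor S T F"
    and F_ff: "fully_faithful S T F"
begin

lemma F_functor: "is_functor S T F"
  using F_linear by (simp add: linear_functor_def)

lemmas F_Obj = functor_Obj[OF F_functor]

lemma F_hom_iso:
  "X \<in> Obj S \<Longrightarrow> Y \<in> Obj S \<Longrightarrow> hom_iso S T X Y (OMap F X) (OMap F Y) (MMap F)"
  using F_linear F_ff by (auto simp: hom_iso_def linear_functor_def fully_faithful_def)

lemma F_shift: "X \<in> Obj S \<Longrightarrow> isomorphic T (OMap F (shO S X)) (shO T (OMap F X))"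
  using F_exact by (auto simp: exact_functor_def nat_iso_def comp_fctr_def isomorphic_def)

lemma F_dist_tri:
  assumes "dist_tri S X Y Z u v w"
  obtains w' where
    "dist_tri T (OMap F X) (OMap F Y) (OMap F Z) (MMap F u) (MMap F v) w'"
  using F_exact assms unfolding exact_functor_def by blast

lemma F_shift_isomorphic:
  assumes X: "X \<in> Obj S" and XY: "isomorphic T (OMap F X) Y"
  shows "isomorphic T (OMap F (shO S X)) (shO T Y)"
  using T.isomorphic_trans[OF F_shift[OF X] functor_isomorphic[OF T.Shift_functor XY]] .

lemma F_unshift_isomorphic:
  assumes X: "X \<in> Obj S" and XY: "isomorphic T (OMap F X) Y"
  shows "isomorphic T (OMap F (unshO S X)) (unshO T Y)"
proof (rule T.shift_reflects_isomorphic)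
  note uX = S.unshift_Obj[OF X]
  have Y: "Y \<in> Obj T"
    using T.isomorphic_Obj[OF XY] by simp
  show "OMap F (unshO S X) \<in> Obj T" "unshO T Y \<in> Obj T"
    using F_Obj[OF uX] T.unshift_Obj[OF Y] .
  show "isomorphic T (shO T (OMap F (unshO S X))) (shO T (unshO T Y))"
    using T.isomorphic_trans[OF T.isomorphic_sym[OF F_shift[OF uX]]] XY
      S.shift_unshift[OF X] T.shift_unshift[OF Y] by simp
qed

lemma F_shift_by_isomorphic:
  assumes X: "X \<in> Obj S" and XY: "isomorphic T (OMap F X) Y"
  shows "isomorphic T (OMap F (shift_by S i X)) (shift_by T i Y)"
proof -
  have "(shO S ^^ n) X \<in> Obj S \<and> isomorphic T (OMap F ((shO S ^^ n) X)) ((shO T ^^ n) Y)" for n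
    by (induction n) (simp_all add: X XY S.shift_Obj F_shift_isomorphic)
  moreover have
    "(unshO S ^^ n) X \<in> Obj S \<and> isomorphic T (OMap F ((unshO S ^^ n) X)) ((unshO T ^^ n) Y)" for n
    by (induction n) (simp_all add: X XY S.unshift_Obj F_unshift_isomorphic)
  ultimately show ?thesis
    by (simp add: shift_by_def)
qed

lemma F_hom_iso_isomorphic:
  assumes O: "X \<in> Obj S" "Y \<in> Obj S"
    and f: "f \<in> Hom T (OMap F X) X'" "f' \<in> Hom T X' (OMap F X)"
      "f' \<cdot>\<^bsub>T\<^esub> f = Ident T (OMap F X)" "f \<cdot>\<^bsub>T\<^esub> f' = Ident T X'"
    and g: "g \<in> Hom T (OMap F Y) Y'" "g' \<in> Hom T Y' (OMap F Y)"
      "g' \<cdot>\<^bsub>T\<^esub> g = Ident T (OMap F Y)" "g \<cdot>\<^bsub>T\<^esub> g' = Ident T Y'"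
    and O': "X' \<in> Obj T" "Y' \<in> Obj T"
  shows "hom_iso S T X Y X' Y' (\<lambda>h. g \<cdot>\<^bsub>T\<^esub> (MMap F h \<cdot>\<^bsub>T\<^esub> f'))"
  using hom_iso_comp[OF F_hom_iso[OF O] T.hom_iso_conjugation[OF f g F_Obj[OF O(1)] O'(1)
        F_Obj[OF O(2)] O'(2)]] .

lemma hom_iso_exists:
  assumes O: "X \<in> Obj S" "Y \<in> Obj S"
    and XX': "isomorphic T (OMap F X) X'" and YY': "isomorphic T (OMap F Y) Y'"
  obtains \<phi> where "hom_iso S T X Y X' Y' \<phi>"
proof -
  obtain f g where "iso_arr T (OMap F X) X' f" "iso_arr T (OMap F Y) Y' g"
    using XX' YY' by (auto simp: isomorphic_def)
  then obtain f' g' where "f \<in> Hom T (OMap F X) X'" "f' \<in> Hom T X' (OMap F X)"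
      "f' \<cdot>\<^bsub>T\<^esub> f = Ident T (OMap F X)" "f \<cdot>\<^bsub>T\<^esub> f' = Ident T X'"
      "g \<in> Hom T (OMap F Y) Y'" "g' \<in> Hom T Y' (OMap F Y)"
      "g' \<cdot>\<^bsub>T\<^esub> g = Ident T (OMap F Y)" "g \<cdot>\<^bsub>T\<^esub> g' = Ident T Y'" "X' \<in> Obj T" "Y' \<in> Obj T"
    unfolding iso_arr_def by blast
  from F_hom_iso_isomorphic[OF O this] show ?thesis
    using that by blast
qed

text \<open>The bijection \<open>Hom(X, X) \<rightarrow> Hom(X', X')\<close> has to send identity to identity, so the same
  isomorphism \<open>f\<close> is used at both ends.\<close>

lemma exceptional_iff:
  assumes X: "X \<in> Obj S" and XX': "isomorphic T (OMap F X) X'"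
  shows "exceptional S X \<longleftrightarrow> exceptional T X'"
proof -
  obtain f where "iso_arr T (OMap F X) X' f"
    using XX' by (auto simp: isomorphic_def)
  then obtain f' where f: "f \<in> Hom T (OMap F X) X'" "f' \<in> Hom T X' (OMap F X)"
      "f' \<cdot>\<^bsub>T\<^esub> f = Ident T (OMap F X)" "f \<cdot>\<^bsub>T\<^esub> f' = Ident T X'" and X': "X' \<in> Obj T"
    unfolding iso_arr_def by blast
  define \<phi> where "\<phi> = (\<lambda>h. f \<cdot>\<^bsub>T\<^esub> (MMap F h \<cdot>\<^bsub>T\<^esub> f'))"
  have \<phi>: "hom_iso S T X X X' X' \<phi>"
    unfolding \<phi>_def using F_hom_iso_isomorphic[OF X X f f X' X'] .
  have "\<phi> (Ident S X) = Ident T X'"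
    unfolding \<phi>_def using functor_Ident[OF F_functor X] T.Ident_left[OF X' F_Obj[OF X] f(2)] f(4)
    by simp
  then have sc: "\<phi> (Scale S c (Ident S X)) = Scale T c (Ident T X')" for c
    using hom_iso_Scale[OF \<phi> S.Ident_in_Hom[OF X]] by simp
  have "bij_betw (\<lambda>c. Scale S c (Ident S X)) UNIV (Hom S X X) \<longleftrightarrow>
      bij_betw (\<phi> \<circ> (\<lambda>c. Scale S c (Ident S X))) UNIV (Hom T X' X')"
    using bij_betw_comp_iff2[of \<phi> "Hom S X X" "Hom T X' X'" "\<lambda>c. Scale S c (Ident S X)" UNIV] \<phi>
      S.Scale_in_Hom[OF X X S.Ident_in_Hom[OF X]] by (auto simp: hom_iso_def)
  also have "\<phi> \<circ> (\<lambda>c. Scale S c (Ident S X)) = (\<lambda>c. Scale T c (Ident T X'))"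
    using sc by auto
  finally have e: "bij_betw (\<lambda>c. Scale S c (Ident S X)) UNIV (Hom S X X) \<longleftrightarrow>
      bij_betw (\<lambda>c. Scale T c (Ident T X')) UNIV (Hom T X' X')" .
  have "Hom S X (shift_by S i X) = {Zero S X (shift_by S i X)} \<longleftrightarrow>
      Hom T X' (shift_by T i X') = {Zero T X' (shift_by T i X')}" for i
    using hom_iso_exists[OF X S.shift_by_Obj[OF X] XX' F_shift_by_isomorphic[OF X XX']]
      hom_iso_vanish by metis
  with e show ?thesis
    using X X' by (simp add: exceptional_def)
qed

lemma in_image_subcat_iff:
  "Y \<in> image_subcat T F B \<longleftrightarrow> (\<exists>A \<in> B. isomorphic T (OMap F A) Y)"
  unfolding image_subcat_def using T.isomorphic_sym T.isomorphic_Obj by blast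

lemma F_in_image_subcat: "B \<subseteq> Obj S \<Longrightarrow> A \<in> B \<Longrightarrow> OMap F A \<in> image_subcat T F B"
  unfolding in_image_subcat_iff using T.isomorphic_refl F_Obj by blast

text \<open>A morphism between objects of the image comes from \<open>S\<close>, and so does its cone, because
  cones are unique up to isomorphism.\<close>

lemma triangulated_subcategory_image:
  assumes B: "triangulated_subcategory S B"
  shows "triangulated_subcategory T (image_subcat T F B)"
proof (rule T.triangulated_subcategoryI_cone)
  note BO = subsetD[OF S.triangulated_subcategory_subset[OF B]]
  have "B \<noteq> {}"
    using B unfolding triangulated_subcategory_def by (elim conjE)
  then show "image_subcat T F B \<noteq> {}"
    using F_in_image_subcat[OF S.triangulated_subcategory_subset[OF B]] by blast
  show "image_subcat T F B \<subseteq> Obj T"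
    by (auto simp: image_subcat_def)
  show "shO T X \<in> image_subcat T F B" if "X \<in> image_subcat T F B" for X
    using that F_shift_isomorphic[OF BO] S.triangulated_subcategory_shift[OF B]
    unfolding in_image_subcat_iff by blast
  show "unshO T X \<in> image_subcat T F B" if "X \<in> image_subcat T F B" for X
    using that F_unshift_isomorphic[OF BO] S.triangulated_subcategory_unshift[OF B]
    unfolding in_image_subcat_iff by blast
  show "Z \<in> image_subcat T F B"
    if d: "dist_tri T X Y Z u v w" and X: "X \<in> image_subcat T F B" and Y: "Y \<in> image_subcat T F B"
    for X Y Z u v w
  proof -
    note D = T.dist_triD[OF d]
    obtain A where A: "A \<in> B" "isomorphic T X (OMap F A)"
      using X by (auto simp: image_subcat_def)
    obtain A' where A': "A' \<in> B" "isomorphic T Y (OMap F A')"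
      using Y by (auto simp: image_subcat_def)
    obtain f where f: "iso_arr T X (OMap F A) f"
      using A by (auto simp: isomorphic_def)
    obtain f' where f': "iso_arr T (OMap F A) X f'" "f' \<cdot>\<^bsub>T\<^esub> f = Ident T X"
      using f by (rule T.iso_arr_inverse)
    obtain g where g: "iso_arr T Y (OMap F A') g"
      using A' by (auto simp: isomorphic_def)
    have H: "f \<in> Hom T X (OMap F A)" "f' \<in> Hom T (OMap F A) X" "g \<in> Hom T Y (OMap F A')"
      using f f' g by (auto simp: iso_arr_def)
    note FA = F_Obj[OF BO[OF A(1)]] and FA' = F_Obj[OF BO[OF A'(1)]]
    have gu: "g \<cdot>\<^bsub>T\<^esub> u \<in> Hom T X (OMap F A')"
      using T.Comp_in_Hom[OF D(1,2) FA' D(4) H(3)] .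
    then have "(g \<cdot>\<^bsub>T\<^esub> u) \<cdot>\<^bsub>T\<^esub> f' \<in> Hom T (OMap F A) (OMap F A')"
      using T.Comp_in_Hom[OF FA D(1) FA' H(2)] by blast
    then obtain a where a: "a \<in> Hom S A A'" "MMap F a = (g \<cdot>\<^bsub>T\<^esub> u) \<cdot>\<^bsub>T\<^esub> f'"
      using fully_faithful_preimage[OF F_ff BO[OF A(1)] BO[OF A'(1)]] by blast
    obtain E b c where E: "dist_tri S A A' E a b c"
      using S.TR1_cone[OF BO[OF A(1)] BO[OF A'(1)] a(1)] by blast
    obtain c' where c': "dist_tri T (OMap F A) (OMap F A') (OMap F E) (MMap F a) (MMap F b) c'"
      using F_dist_tri[OF E] .
    have "g \<cdot>\<^bsub>T\<^esub> u = MMap F a \<cdot>\<^bsub>T\<^esub> f"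
      using T.cancel_right[OF D(1) FA FA' H(1,2) gu f'(2)] a(2) by simp
    then have "isomorphic T Z (OMap F E)"
      using T.cone_unique[OF d c' f g] by blast
    moreover have "E \<in> B"
      using S.triangulated_subcategory_cone[OF B E A(1) A'(1)] .
    ultimately show ?thesis
      using D(3) by (auto simp: image_subcat_def)
  qed
qed

lemma image_subcat_subset_iff:
  assumes x: "triangulated_subcategory S x" and y: "triangulated_subcategory S y"
  shows "image_subcat T F x \<subseteq> image_subcat T F y \<longleftrightarrow> x \<subseteq> y"
proof
  show "image_subcat T F x \<subseteq> image_subcat T F y" if "x \<subseteq> y"
    using that by (auto simp: image_subcat_def)
  show "x \<subseteq> y" if le: "image_subcat T F x \<subseteq> image_subcat T F y"
  proof
    note xO = S.triangulated_subcategory_subset[OF x] and yO = S.triangulated_subcategory_subset[OF y]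
    fix A assume A: "A \<in> x"
    then have "OMap F A \<in> image_subcat T F y"
      using F_in_image_subcat[OF xO] le by blast
    then obtain A' where A': "A' \<in> y" "isomorphic T (OMap F A') (OMap F A)"
      unfolding in_image_subcat_iff by blast
    then have "isomorphic S A' A"
      using fully_faithful_reflects_isomorphic[OF S.category_axioms F_functor F_ff] A xO yO by blast
    then show "A \<in> y"
      using S.triangulated_subcategory_isomorphic[OF y A'(1)] by blast
  qed
qed

lemma image_subcat_eq_iff:
  assumes "triangulated_subcategory S x" "triangulated_subcategory S y"
  shows "image_subcat T F x = image_subcat T F y \<longleftrightarrow> x = y"
  using image_subcat_subset_iff[OF assms] image_subcat_subset_iff[OF assms(2,1)] by blast

text \<open>The object \<open>E\<close> only serves to make the preimage non-empty.\<close>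

lemma triangulated_subcategory_preimage:
  assumes B: "triangulated_subcategory T B" and E: "E \<in> Obj S" "OMap F E \<in> B"
  shows "triangulated_subcategory S {A \<in> Obj S. OMap F A \<in> B}"
proof (rule S.triangulated_subcategoryI_cone)
  note iso = T.triangulated_subcategory_isomorphic[OF B _ T.isomorphic_sym]
  show "{A \<in> Obj S. OMap F A \<in> B} \<noteq> {}"
    using E by blast
  show "{A \<in> Obj S. OMap F A \<in> B} \<subseteq> Obj S"
    by blast
  fix X assume "X \<in> {A \<in> Obj S. OMap F A \<in> B}"
  then have X: "X \<in> Obj S" "OMap F X \<in> B"
    by auto
  note r = T.isomorphic_refl[OF F_Obj[OF X(1)]]
  show "shO S X \<in> {A \<in> Obj S. OMap F A \<in> B}"
    using iso[OF T.triangulated_subcategory_shift[OF B X(2)] F_shift_isomorphic[OF X(1) r]]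
      S.shift_Obj[OF X(1)] by simp
  show "unshO S X \<in> {A \<in> Obj S. OMap F A \<in> B}"
    using iso[OF T.triangulated_subcategory_unshift[OF B X(2)] F_unshift_isomorphic[OF X(1) r]]
      S.unshift_Obj[OF X(1)] by simp
next
  fix X Y Z u v w
  assume d: "dist_tri S X Y Z u v w"
    and XY: "X \<in> {A \<in> Obj S. OMap F A \<in> B}" "Y \<in> {A \<in> Obj S. OMap F A \<in> B}"
  obtain w' where "dist_tri T (OMap F X) (OMap F Y) (OMap F Z) (MMap F u) (MMap F v) w'"
    using F_dist_tri[OF d] .
  then have "OMap F Z \<in> B"
    using T.triangulated_subcategory_cone[OF B] XY by blast
  then show "Z \<in> {A \<in> Obj S. OMap F A \<in> B}"
    using S.dist_triD(3)[OF d] by simp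
qed

text \<open>One inclusion holds because the image of \<open>\<langle>E\<rangle>\<close> is triangulated, the other because the
  preimage of \<open>\<langle>E'\<rangle>\<close> is.\<close>

lemma image_subcat_generated:
  assumes E: "E \<in> Obj S" and EE': "isomorphic T (OMap F E) E'"
  shows "image_subcat T F (generated S E) = generated T E'"
proof
  note tS = S.triangulated_subcategory_generated[OF E]
  have E': "E' \<in> Obj T"
    using T.isomorphic_Obj[OF EE'] by simp
  note tT = T.triangulated_subcategory_generated[OF E']
  have "E' \<in> image_subcat T F (generated S E)"
    using EE' S.generated_self unfolding in_image_subcat_iff by blast
  then show "generated T E' \<subseteq> image_subcat T F (generated S E)"
    by (rule T.generated_least[OF triangulated_subcategory_image[OF tS]])
  have FE: "OMap F E \<in> generated T E'"
    using T.triangulated_subcategory_isomorphic[OF tT T.generated_self T.isomorphic_sym[OF EE']] .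
  have "generated S E \<subseteq> {A \<in> Obj S. OMap F A \<in> generated T E'}"
    by (rule S.generated_least[OF triangulated_subcategory_preimage[OF tT E FE]]) (use E FE in simp)
  then show "image_subcat T F (generated S E) \<subseteq> generated T E'"
    using T.triangulated_subcategory_isomorphic[OF tT] unfolding subset_iff in_image_subcat_iff
    by blast
qed

lemma image_subcat_in_C_set:
  assumes J: "\<And>A. A \<in> J \<Longrightarrow> triangulated_category A" and x: "x \<in> C_set J S"
  shows "image_subcat T F x \<in> C_set J T"
proof -
  let ?y = "image_subcat T F x" and ?S = "full_subcat S x"
  let ?T = "full_subcat T ?y"
  have tx: "triangulated_subcategory S x"
    using x by (simp add: C_set_def)
  note ty = triangulated_subcategory_image[OF tx]
  note xO = S.triangulated_subcategory_subset[OF tx] and yO = T.triangulated_subcategory_subset[OF ty]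
  note xO' = subsetD[OF xO] and Fx = F_in_image_subcat[OF xO]
  obtain A \<Phi> where A: "A \<in> J" and \<Phi>: "linear_exact_equivalence A ?S \<Phi>"
    using x by (auto simp: C_set_def)
  note cS = category_full_subcat[OF S.category_axioms xO]
    and cT = category_full_subcat[OF T.category_axioms yO]
  have f: "is_functor ?S ?T F"
    unfolding is_functor_def full_subcat_sel
    using Fx functor_Hom[OF F_functor xO' xO'] functor_Ident[OF F_functor xO']
      functor_Comp[OF F_functor xO' xO' xO'] by blast
  have lin: "linear_functor ?S ?T F"
    using f F_linear xO' by (simp add: linear_functor_def)
  have ex: "exact_functor ?S ?T F"
  proof -
    obtain \<eta> where \<eta>: "nat_iso S T (comp_fctr F (Shift S)) (comp_fctr (Shift T) F) \<eta>"
        "\<And>X Y Z u v w. dist_tri S X Y Z u v w \<Longrightarrow> dist_tri T (OMap F X) (OMap F Y) (OMap F Z)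
          (MMap F u) (MMap F v) (\<eta> X \<cdot>\<^bsub>T\<^esub> MMap F w)"
      using F_exact by (auto simp: exact_functor_def)
    have "nat_iso ?S ?T (comp_fctr F (Shift ?S)) (comp_fctr (Shift ?T) F) \<eta>"
      using \<eta>(1) xO' Fx S.triangulated_subcategory_shift[OF tx] T.triangulated_subcategory_shift[OF ty]
      unfolding nat_iso_def comp_fctr_def by (simp add: iso_arr_full_subcat[OF yO])
    moreover have "dist_tri ?T (OMap F X) (OMap F Y) (OMap F Z)
        (MMap F u) (MMap F v) (\<eta> X \<cdot>\<^bsub>?T\<^esub> MMap F w)" if "dist_tri ?S X Y Z u v w" for X Y Z u v w
      using that \<eta>(2) Fx by (simp add: dist_tri_full_subcat[OF xO] dist_tri_full_subcat[OF yO])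
    ultimately show ?thesis
      unfolding exact_functor_def using f by blast
  qed
  interpret A: triangulated_category A
    using J[OF A] .
  have shS: "is_functor ?S ?S (Shift ?S)" and shT: "is_functor ?T ?T (Shift ?T)"
    using S.is_functor_Shift_full_subcat[OF tx] T.is_functor_Shift_full_subcat[OF ty] .
  have "equivalence ?S ?T F"
  proof (rule equivalence_if_fully_faithful_ess_surj[OF cS cT f])
    show "fully_faithful ?S ?T F"
      using F_ff xO' by (simp add: fully_faithful_def)
    show "\<exists>X \<in> Obj ?S. isomorphic ?T (OMap F X) Y" if "Y \<in> Obj ?T" for Y
      using that Fx by (auto simp: in_image_subcat_iff isomorphic_def iso_arr_full_subcat[OF yO])
  qed
  then show ?thesis
    using linear_functor_comp[OF _ lin] exact_functor_comp[OF cT _ ex A.Shift_functor shS shT]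
      equivalence_comp[OF A.category_axioms cT] \<Phi> ty A
    unfolding C_set_def linear_exact_equivalence_def by blast
qed

lemma hom_vanish_image_subcat_iff:
  assumes a: "a \<subseteq> Obj S" and b: "b \<subseteq> Obj S"
  shows "(\<forall>X \<in> image_subcat T F b. \<forall>Y \<in> image_subcat T F a. Hom T X Y = {Zero T X Y}) \<longleftrightarrow>
    (\<forall>X \<in> b. \<forall>Y \<in> a. Hom S X Y = {Zero S X Y})"
proof -
  have v: "Hom T X' Y' = {Zero T X' Y'} \<longleftrightarrow> Hom S X Y = {Zero S X Y}"
    if "X \<in> b" "Y \<in> a" "isomorphic T (OMap F X) X'" "isomorphic T (OMap F Y) Y'" for X Y X' Y'
    using hom_iso_exists[OF subsetD[OF b that(1)] subsetD[OF a that(2)] that(3,4)] hom_iso_vanish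
    by metis
  show ?thesis
  proof (intro iffI ballI)
    fix X Y assume XY: "X \<in> b" "Y \<in> a"
      and h: "\<forall>X \<in> image_subcat T F b. \<forall>Y \<in> image_subcat T F a. Hom T X Y = {Zero T X Y}"
    have "Hom T (OMap F X) (OMap F Y) = {Zero T (OMap F X) (OMap F Y)}"
      using h F_in_image_subcat[OF b XY(1)] F_in_image_subcat[OF a XY(2)] by blast
    then show "Hom S X Y = {Zero S X Y}"
      using v[OF XY] T.isomorphic_refl[OF F_Obj] XY a b by blast
  next
    fix X' Y' assume XY: "X' \<in> image_subcat T F b" "Y' \<in> image_subcat T F a"
      and h: "\<forall>X \<in> b. \<forall>Y \<in> a. Hom S X Y = {Zero S X Y}"
    then obtain X Y where "X \<in> b" "Y \<in> a" "isomorphic T (OMap F X) X'" "isomorphic T (OMap F Y) Y'"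
      unfolding in_image_subcat_iff by blast
    then show "Hom T X' Y' = {Zero T X' Y'}"
      using v h by blast
  qed
qed

lemma image_edge_iff:
  assumes J: "\<And>A. A \<in> J \<Longrightarrow> triangulated_category A" and a: "a \<in> C_set J S" and b: "b \<in> C_set J S"
  shows "(image_subcat T F a, image_subcat T F b) \<in> parcs (G_graph J T) \<longleftrightarrow>
    (a, b) \<in> parcs (G_graph J S)"
proof -
  have t: "triangulated_subcategory S a" "triangulated_subcategory S b"
    using a b by (auto simp: C_set_def)
  show ?thesis
    using image_subcat_in_C_set[OF J a] image_subcat_in_C_set[OF J b] a b image_subcat_eq_iff[OF t]
      hom_vanish_image_subcat_iff[OF t[THEN S.triangulated_subcategory_subset]]
    by (simp add: G_graph_def)
qed

lemma image_simplex:
  assumes J: "\<And>A. A \<in> J \<Longrightarrow> triangulated_category A" and \<sigma>: "\<sigma> \<in> SC_simplices J S"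
  shows "image_subcat T F ` \<sigma> \<in> SC_simplices J T"
proof -
  obtain xs where xs: "\<sigma> = set xs" "xs \<noteq> []" "distinct xs" "set xs \<subseteq> C_set J S"
      "\<And>i j. i < j \<Longrightarrow> j < length xs \<Longrightarrow> (xs ! i, xs ! j) \<in> parcs (G_graph J S)"
    using \<sigma> by (auto simp: SC_simplices_def)
  let ?ys = "map (image_subcat T F) xs"
  have "inj_on (image_subcat T F) (set xs)"
  proof (rule inj_onI)
    fix x y assume "x \<in> set xs" "y \<in> set xs" "image_subcat T F x = image_subcat T F y"
    moreover from this have "triangulated_subcategory S x" "triangulated_subcategory S y"
      using xs(4) by (auto simp: C_set_def)
    ultimately show "x = y"
      using image_subcat_eq_iff by blast
  qed
  then have "distinct ?ys"
    using xs(3) by (simp add: distinct_map)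
  moreover have "set ?ys \<subseteq> C_set J T"
    using image_subcat_in_C_set[OF J] xs(4) by auto
  moreover have "(?ys ! i, ?ys ! j) \<in> parcs (G_graph J T)" if "i < j" "j < length ?ys" for i j
  proof -
    have "xs ! i \<in> C_set J S" "xs ! j \<in> C_set J S"
      using that xs(4) nth_mem[of i xs] nth_mem[of j xs] by auto
    then show ?thesis
      using image_edge_iff[OF J] xs(5)[of i j] that by simp
  qed
  ultimately show ?thesis
    unfolding SC_simplices_def using xs(1,2) by (auto intro!: exI[of _ ?ys])
qed

text \<open>The witnesses \<open>X, Y\<close> of a value transfer along \<open>F\<close>.  Conversely, the generators \<open>X', Y'\<close> of
  the two images are isomorphic to \<open>F X, F Y\<close> with \<open>X\<close> in \<open>a\<close> and \<open>Y\<close> in \<open>b\<close>, and \<open>X, Y\<close>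
  generate \<open>a, b\<close> because \<open>F\<close> is injective on triangulated subcategories.  So the possible values
  are the same on both sides, whether or not the value is unique.\<close>

lemma is_edge_number_image_iff:
  assumes a: "triangulated_subcategory S a" and b: "triangulated_subcategory S b"
  shows "is_edge_number T (image_subcat T F a) (image_subcat T F b) n \<longleftrightarrow> is_edge_number S a b n"
proof -
  have dims: "(\<Sum>\<^sub>\<infinity> i \<in> UNIV. hom_dim S X (shift_by S i Y)) =
      (\<Sum>\<^sub>\<infinity> i \<in> UNIV. hom_dim T X' (shift_by T i Y'))"
    if X: "X \<in> Obj S" "isomorphic T (OMap F X) X'" and Y: "Y \<in> Obj S" "isomorphic T (OMap F Y) Y'"
    for X Y X' Y'
  proof (rule infsum_cong)
    show "hom_dim S X (shift_by S i Y) = hom_dim T X' (shift_by T i Y')" for i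
      using hom_iso_exists[OF X(1) S.shift_by_Obj[OF Y(1)] X(2) F_shift_by_isomorphic[OF Y]]
        hom_iso_dim by metis
  qed
  show ?thesis
  proof
    assume "is_edge_number S a b n"
    then obtain X Y where XY: "exceptional S X" "exceptional S Y" "a = generated S X"
        "b = generated S Y" "n = (\<Sum>\<^sub>\<infinity> i \<in> UNIV. hom_dim S X (shift_by S i Y))"
      by (auto simp: is_edge_number_def)
    then have O: "X \<in> Obj S" "Y \<in> Obj S"
      by (auto simp: exceptional_def)
    note r = O[THEN F_Obj, THEN T.isomorphic_refl]
    show "is_edge_number T (image_subcat T F a) (image_subcat T F b) n"
      unfolding is_edge_number_def
      using XY exceptional_iff[OF O(1) r(1)] exceptional_iff[OF O(2) r(2)]
        image_subcat_generated[OF O(1) r(1)] image_subcat_generated[OF O(2) r(2)]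
        dims[OF O(1) r(1) O(2) r(2)]
      by (intro exI[of _ "OMap F X"] exI[of _ "OMap F Y"]) simp
  next
    assume "is_edge_number T (image_subcat T F a) (image_subcat T F b) n"
    then obtain X' Y' where XY: "exceptional T X'" "exceptional T Y'"
        "image_subcat T F a = generated T X'" "image_subcat T F b = generated T Y'"
        "n = (\<Sum>\<^sub>\<infinity> i \<in> UNIV. hom_dim T X' (shift_by T i Y'))"
      by (auto simp: is_edge_number_def)
    obtain X where X: "X \<in> a" "isomorphic T (OMap F X) X'"
      using XY(3) T.generated_self[of X'] in_image_subcat_iff by blast
    obtain Y where Y: "Y \<in> b" "isomorphic T (OMap F Y) Y'"
      using XY(4) T.generated_self[of Y'] in_image_subcat_iff by blast
    have O: "X \<in> Obj S" "Y \<in> Obj S"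
      using X Y S.triangulated_subcategory_subset[OF a] S.triangulated_subcategory_subset[OF b]
      by auto
    have "a = generated S X"
      using image_subcat_eq_iff[OF a S.triangulated_subcategory_generated[OF O(1)]]
        image_subcat_generated[OF O(1) X(2)] XY(3) by simp
    moreover have "b = generated S Y"
      using image_subcat_eq_iff[OF b S.triangulated_subcategory_generated[OF O(2)]]
        image_subcat_generated[OF O(2) Y(2)] XY(4) by simp
    ultimately show "is_edge_number S a b n"
      unfolding is_edge_number_def
      using XY exceptional_iff[OF O(1) X(2)] exceptional_iff[OF O(2) Y(2)]
        dims[OF O(1) X(2) O(2) Y(2)] by (intro exI[of _ X] exI[of _ Y]) simp
  qed
qed

end

theorem theorem1p1:
  fixes J :: "('oj, 'mj, 'k::field) tricat set"
    and T1 :: "('o1, 'm1, 'k) tricat"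
    and T2 :: "('o2, 'm2, 'k) tricat"
    and F :: "('o1, 'm1, 'o2, 'm2) fctr"
  assumes J_triangulated: "\<And>A. A \<in> J \<Longrightarrow> triangulated_category A"
    and J_nonequivalent: "pairwise_nonequivalent J"
    and T1: "triangulated_category T1"
    and T2: "triangulated_category T2"
    and F_linear: "linear_functor T1 T2 F"
    and F_exact: "exact_functor T1 T2 F"
    and F_ff: "fully_faithful T1 T2 F"
  shows "(image_subcat T2 F \<in> C_set J T1 \<rightarrow> C_set J T2) \<and>
    inj_on (image_subcat T2 F) (C_set J T1) \<and>
    (\<forall>x \<in> C_set J T1. \<forall>y \<in> C_set J T1.
       x \<subseteq> y \<longleftrightarrow> image_subcat T2 F x \<subseteq> image_subcat T2 F y) \<and>
    (\<forall>a \<in> C_set J T1. \<forall>b \<in> C_set J T1.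
       (a, b) \<in> parcs (G_graph J T1) \<longleftrightarrow>
       (image_subcat T2 F a, image_subcat T2 F b) \<in> parcs (G_graph J T2)) \<and>
    (\<forall>\<sigma> \<in> SC_simplices J T1. image_subcat T2 F ` \<sigma> \<in> SC_simplices J T2) \<and>
    (\<forall>a b. one_sided_edge {Db_A1 :: ('k complex_vs, 'k dmor, 'k) tricat} T1 a b \<longrightarrow>
       (\<forall>n. is_edge_number T1 a b n \<longleftrightarrow>
            is_edge_number T2 (image_subcat T2 F a) (image_subcat T2 F b) n) \<and>
       edge_number T1 a b = edge_number T2 (image_subcat T2 F a) (image_subcat T2 F b))"
proof -
  interpret ff_exact_functor T1 T2 F
    using T1 T2 F_linear F_exact F_ff
    by (intro ff_exact_functor.intro ff_exact_functor_axioms.intro)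
  have tri: "triangulated_subcategory T1 x" if "x \<in> C_set J T1" for x
    using that by (simp add: C_set_def)
  show ?thesis
  proof (intro conjI)
    show "image_subcat T2 F \<in> C_set J T1 \<rightarrow> C_set J T2"
      using image_subcat_in_C_set[OF J_triangulated] by blast
    show "inj_on (image_subcat T2 F) (C_set J T1)"
      using image_subcat_eq_iff[OF tri tri] by (simp add: inj_on_def)
    show "\<forall>x \<in> C_set J T1. \<forall>y \<in> C_set J T1.
        x \<subseteq> y \<longleftrightarrow> image_subcat T2 F x \<subseteq> image_subcat T2 F y"
      using image_subcat_subset_iff[OF tri tri] by simp
    show "\<forall>a \<in> C_set J T1. \<forall>b \<in> C_set J T1. (a, b) \<in> parcs (G_graph J T1) \<longleftrightarrow>
        (image_subcat T2 F a, image_subcat T2 F b) \<in> parcs (G_graph J T2)"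
      using image_edge_iff[OF J_triangulated] by simp
    show "\<forall>\<sigma> \<in> SC_simplices J T1. image_subcat T2 F ` \<sigma> \<in> SC_simplices J T2"
      using image_simplex[OF J_triangulated] by simp
    show "\<forall>a b. one_sided_edge {Db_A1 :: ('k complex_vs, 'k dmor, 'k) tricat} T1 a b \<longrightarrow>
       (\<forall>n. is_edge_number T1 a b n \<longleftrightarrow>
            is_edge_number T2 (image_subcat T2 F a) (image_subcat T2 F b) n) \<and>
       edge_number T1 a b = edge_number T2 (image_subcat T2 F a) (image_subcat T2 F b)"
    proof (intro allI impI)
      fix a b assume "one_sided_edge {Db_A1 :: ('k complex_vs, 'k dmor, 'k) tricat} T1 a b"
      then have "triangulated_subcategory T1 a" "triangulated_subcategory T1 b"
        by (auto simp: one_sided_edge_def G_graph_def C_set_def)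
      then show "(\<forall>n. is_edge_number T1 a b n \<longleftrightarrow>
            is_edge_number T2 (image_subcat T2 F a) (image_subcat T2 F b) n) \<and>
          edge_number T1 a b = edge_number T2 (image_subcat T2 F a) (image_subcat T2 F b)"
        by (simp add: is_edge_number_image_iff edge_number_def)
    qed
  qed
qed

end
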